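(* Let $\Delta t>0$ and let $u_h^{n-1}\in V_h$ be given. If the triangulation $\Omega_h$ is Delaunay, then the solution $u_h^n\in V_h$ to the fully discrete scheme, with mass lumping used for the mass operator and edge-based integration used for the stiffness operator, $$\mathcal{M}_h\left(\frac{\exp(u_h^n)-\exp(u_h^{n-1})}{\Delta t},v_h\right)+\mathcal{A}_h\left(m\exp(m u_h^{n-1});u_h^n,v_h\right)=0\qquad\text{for all } v_h\in V_h,$$ is uniformly bounded. That is, given $0<\varepsilon_1<\varepsilon_2$ such that $\varepsilon_1\le\exp(u_h^{n-1})\le\varepsilon_2$, one has $\varepsilon_1\le\exp(u_h^n)\le\varepsilon_2$.
   Context: The scheme discretizes the porous medium equation $\partial_t\rho-\nabla\cdot\nabla(\rho^m)=0$, $m\ge1$, written in the log-density variable $u=\log\rho$, that is $\partial_t\exp(u)-\nabla\cdot(m\exp(mu)\nabla u)=0$ in $\Omega$ with $\partial u/\partial n=0$ on $\partial\Omega$ and $u(0,x)=\log\rho^0(x)$. Here $\Omega\subset\mathbb{R}^d$, $d=1,2,3$, is a bounded polyhedral domain, and the initial density $\rho^0$ is assumed positive everywhere in $\Omega$. The function $u_h^n$ approximates $u$ at time $t^n=t^{n-1}+\Delta t$. $\Omega_h$ is a conforming simplicial triangulation of $\Omega$, $\mathcal{E}_h$ is the set of its edges, and $v_1,\dots,v_{N_V}$ are its vertices. For $K\in\Omega_h$, $\mathcal{E}_K$ is the set of edges of $K$, $\mathcal{V}_K$ the set of its vertices, and $|K|$ its volume. The finite element space is $V_h=\{v_h\in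 H^1(\Omega): v_h|_K\in P_1(K)\text{ for all }K\in\Omega_h\}$, where $P_1(K)$ is the space of linear polynomials on $K$. Mass-lumped mass operator: $$\mathcal{M}_h(\alpha,\beta)=\sum_{K\in\Omega_h}\sum_{v\in\mathcal{V}_K}\frac{|K|}{d+1}\,\alpha(v)\,\beta(v)=\sum_{i=1}^{N_V}\frac{|S_i|}{d+1}\,\alpha(v_i)\,\beta(v_i),$$ where $S_i$ is the union of the closed elements containing the vertex $v_i$ and $|S_i|$ is its volume. Edge-based stiffness operator, an integration formula for $\int_\Omega\gamma\nabla\alpha\cdot\nabla\beta\,dx$: $$\mathcal{A}_h(\gamma;\alpha,\beta)=\sum_{K\in\Omega_h}\sum_{E\in\mathcal{E}_K}\omega_E^K\,\tilde\gamma_E\,\delta_E(\alpha)\,\delta_E(\beta)=\sum_{E\in\mathcal{E}_h}\omega_E\,\tilde\gamma_E\,\delta_E(\alpha)\,\delta_E(\beta),\qquad \omega_E=\sum_{K\supset E}\omega_E^K.$$ For an edge $E$ with vertices $v_i$ and $v_j$, $\delta_E(w)=w(v_i)-w(v_j)$; $\tilde\gamma_E=\left[\frac{1}{|E|}\int_E\frac{1}{\gamma}\,ds\right]^{-1}$ is the harmonic average of $\gamma$ on $E$; and the weights are $$\omega_E^K=\frac{1}{d(d-1)}\,|\kappa_E^K|\cot\theta_E^K,$$ where $\theta_E^K$ is the angle between the faces of $K$ not containing $E$, and $\kappa_E^K$ is the $(d-2)$-dimensional simplex formed by their intersection.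
   Formalization: Besides Delaunay (empty circumspheres), the formal theorem assumes ω_E ≥ 0 at boundary edges for d=2 and at all edges for d=3; Delaunay alone does not give this, and the bound fails e.g. on a single obtuse triangle. For d=1 the edge weight is taken to be 1/|K|. *)

theory Defs
  imports "HOL-Analysis.Analysis"
begin

subsection \<open>Domain and triangulation\<close>

(* interior (closure Omega) = Omega excludes slits and removed points, so that the boundary really
   consists of faces of the polytopes. *)
definition polyhedral_domain :: "'a::euclidean_space set \<Rightarrow> bool" where
  "polyhedral_domain \<Omega> \<longleftrightarrow>
     open \<Omega> \<and> connected \<Omega> \<and> bounded \<Omega> \<and> \<Omega> \<noteq> {} \<and> interior (closure \<Omega>) = \<Omega> \<and>
     (\<exists>\<P>. finite \<P> \<and> (\<forall>P\<in>\<P>. polytope P) \<and> \<Union>\<P> = closure \<Omega>)"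

(* Elements are closed d-simplices. Conformity (two elements meet in a common, possibly empty,
   face) is part of the library notion triangulation. *)
definition simplicial_mesh :: "'a::euclidean_space set \<Rightarrow> 'a set set \<Rightarrow> bool" where
  "simplicial_mesh \<Omega> T \<longleftrightarrow>
     triangulation T \<and> (\<forall>K\<in>T. int DIM('a) simplex K) \<and> \<Union>T = closure \<Omega>"

definition verts :: "'a::euclidean_space set \<Rightarrow> 'a set" where
  "verts K = {v. v extreme_point_of K}"

definition mesh_verts :: "'a::euclidean_space set set \<Rightarrow> 'a set" where
  "mesh_verts T = (\<Union>K\<in>T. verts K)"

definition mesh_edges :: "'a::euclidean_space set set \<Rightarrow> 'a set set" where
  "mesh_edges T = {E. \<exists>K\<in>T. E edge_of K}"

(* Empty circumspheres. This yields nonnegative edge weights (edge_weight below) for d = 2 at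
   interior edges, but neither at boundary edges (a mesh of one obtuse triangle is Delaunay) nor for
   d = 3 (a mesh of one tetrahedron with an obtuse dihedral angle is Delaunay). *)
definition delaunay :: "'a::euclidean_space set set \<Rightarrow> bool" where
  "delaunay T \<longleftrightarrow>
     (\<forall>K\<in>T. \<exists>c r. verts K \<subseteq> sphere c r \<and> ball c r \<inter> mesh_verts T = {})"

subsection \<open>The finite element space\<close>

primrec times_differentiable :: "nat \<Rightarrow> ('a::euclidean_space \<Rightarrow> real) \<Rightarrow> bool" where
  "times_differentiable 0 f \<longleftrightarrow> continuous_on UNIV f"
| "times_differentiable (Suc k) f \<longleftrightarrow>
     (\<forall>x. f differentiable (at x)) \<and>
     (\<forall>b\<in>Basis. times_differentiable k (\<lambda>x. frechet_derivative f (at x) b))"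

definition test_function :: "'a::euclidean_space set \<Rightarrow> ('a \<Rightarrow> real) \<Rightarrow> bool" where
  "test_function \<Omega> \<phi> \<longleftrightarrow>
     (\<forall>k. times_differentiable k \<phi>) \<and>
     compact (closure {x. \<phi> x \<noteq> 0}) \<and> closure {x. \<phi> x \<noteq> 0} \<subseteq> \<Omega>"

definition L2 :: "'a::euclidean_space set \<Rightarrow> ('a \<Rightarrow> real) set" where
  "L2 \<Omega> = {f. f \<in> borel_measurable (lebesgue_on \<Omega>) \<and>
               integrable (lebesgue_on \<Omega>) (\<lambda>x. (f x)\<^sup>2)}"

definition weak_partial :: "'a::euclidean_space set \<Rightarrow> 'a \<Rightarrow> ('a \<Rightarrow> real) \<Rightarrow> ('a \<Rightarrow> real) \<Rightarrow> bool" where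
  "weak_partial \<Omega> b f g \<longleftrightarrow>
     (\<forall>\<phi>. test_function \<Omega> \<phi> \<longrightarrow>
        integral\<^sup>L (lebesgue_on \<Omega>) (\<lambda>x. f x * frechet_derivative \<phi> (at x) b) =
        - integral\<^sup>L (lebesgue_on \<Omega>) (\<lambda>x. g x * \<phi> x))"

definition H1 :: "'a::euclidean_space set \<Rightarrow> ('a \<Rightarrow> real) set" where
  "H1 \<Omega> = {f \<in> L2 \<Omega>. \<forall>b\<in>Basis. \<exists>g\<in>L2 \<Omega>. weak_partial \<Omega> b f g}"

definition P1_on :: "'a::euclidean_space set \<Rightarrow> ('a \<Rightarrow> real) set" where
  "P1_on K = {f. \<exists>a b. \<forall>x\<in>K. f x = a \<bullet> x + b}"

(* Finite element functions are genuine functions, not classes modulo null sets: the condition on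
   the closed elements selects the continuous representative, which is the one evaluated at
   vertices. Values outside closure Omega are irrelevant. *)
definition V_h :: "'a::euclidean_space set \<Rightarrow> 'a set set \<Rightarrow> ('a \<Rightarrow> real) set" where
  "V_h \<Omega> T = {f \<in> H1 \<Omega>. \<forall>K\<in>T. f \<in> P1_on K}"

subsection \<open>The discrete operators\<close>

definition mass_op :: "'a::euclidean_space set set \<Rightarrow> ('a \<Rightarrow> real) \<Rightarrow> ('a \<Rightarrow> real) \<Rightarrow> real" where
  "mass_op T \<alpha> \<beta> =
     (\<Sum>K\<in>T. \<Sum>v\<in>verts K. measure lebesgue K / (real DIM('a) + 1) * \<alpha> v * \<beta> v)"

(* The order of the two endpoints is chosen arbitrarily; every quantity below is invariant under
   exchanging them. *)
definition edge_ends :: "'a::euclidean_space set \<Rightarrow> 'a \<times> 'a" where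
  "edge_ends E = (SOME (p, q). E = closed_segment p q)"

definition edge_diff :: "'a::euclidean_space set \<Rightarrow> ('a \<Rightarrow> real) \<Rightarrow> real" where
  "edge_diff E w = w (fst (edge_ends E)) - w (snd (edge_ends E))"

definition edge_length :: "'a::euclidean_space set \<Rightarrow> real" where
  "edge_length E = dist (fst (edge_ends E)) (snd (edge_ends E))"

(* Arc-length integral over E, using the constant-speed parametrization on [0,1]. *)
definition edge_integral :: "'a::euclidean_space set \<Rightarrow> ('a \<Rightarrow> real) \<Rightarrow> real" where
  "edge_integral E f =
     integral {0..1} (\<lambda>t. f (linepath (fst (edge_ends E)) (snd (edge_ends E)) t) * edge_length E)"

definition harmonic_avg :: "('a::euclidean_space \<Rightarrow> real) \<Rightarrow> 'a set \<Rightarrow> real" where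
  "harmonic_avg \<gamma> E = inverse (1 / edge_length E * edge_integral E (\<lambda>x. 1 / \<gamma> x))"

definition opposite_facets :: "'a::euclidean_space set \<Rightarrow> 'a set \<Rightarrow> 'a set set" where
  "opposite_facets K E = {F. F facet_of K \<and> \<not> E \<subseteq> F}"

definition kappa :: "'a::euclidean_space set \<Rightarrow> 'a set \<Rightarrow> 'a set" where
  "kappa K E = \<Inter>(opposite_facets K E)"

definition vec_angle :: "'a::euclidean_space \<Rightarrow> 'a \<Rightarrow> real" where
  "vec_angle x y = arccos (x \<bullet> y / (norm x * norm y))"

(* Angle between two facets of a simplex: the angle, in the orthogonal complement of F \<inter> G, between
   the directions that point from F \<inter> G into F and into G. It does not depend on p and q.
   In the plane, F \<inter> G is a single vertex and this is the angle of the triangle there. *)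
definition facet_angle :: "'a::euclidean_space set \<Rightarrow> 'a set \<Rightarrow> real" where
  "facet_angle F G =
     (THE \<theta>. \<exists>p\<in>F - G. \<exists>q\<in>G - F.
        \<theta> = vec_angle (p - closest_point (affine hull (F \<inter> G)) p)
                      (q - closest_point (affine hull (F \<inter> G)) q))"

(* There are exactly two opposite facets, and facet_angle is symmetric. *)
definition theta :: "'a::euclidean_space set \<Rightarrow> 'a set \<Rightarrow> real" where
  "theta K E =
     (THE \<theta>. \<exists>F G. opposite_facets K E = {F, G} \<and> F \<noteq> G \<and> \<theta> = facet_angle F G)"

(* (d-2)-dimensional measure of a (d-2)-simplex for d = 2 (a point) and d = 3 (a segment). *)
definition kappa_measure :: "'a::euclidean_space set \<Rightarrow> real" where
  "kappa_measure S = (if aff_dim S = 0 then 1 else diameter S)"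

(* The cotangent formula is meaningful for d >= 2 only. For d = 1 the element is its own edge and
   the weight 1/|K| is the one for which the stiffness operator with constant coefficient is
   exact, as it is for d >= 2. *)
definition local_weight :: "'a::euclidean_space set \<Rightarrow> 'a set \<Rightarrow> real" where
  "local_weight K E =
     (if DIM('a) = 1 then 1 / measure lebesgue K
      else 1 / (real DIM('a) * (real DIM('a) - 1)) * kappa_measure (kappa K E) * cot (theta K E))"

definition edge_weight :: "'a::euclidean_space set set \<Rightarrow> 'a set \<Rightarrow> real" where
  "edge_weight T E = (\<Sum>K\<in>{K\<in>T. E edge_of K}. local_weight K E)"

definition stiffness_op ::
  "'a::euclidean_space set set \<Rightarrow> ('a \<Rightarrow> real) \<Rightarrow> ('a \<Rightarrow> real) \<Rightarrow> ('a \<Rightarrow> real) \<Rightarrow> real" where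
  "stiffness_op T \<gamma> \<alpha> \<beta> =
     (\<Sum>K\<in>T. \<Sum>E\<in>{E. E edge_of K}.
        local_weight K E * harmonic_avg \<gamma> E * edge_diff E \<alpha> * edge_diff E \<beta>)"

definition scheme_solution ::
  "'a::euclidean_space set \<Rightarrow> 'a set set \<Rightarrow> real \<Rightarrow> real \<Rightarrow> ('a \<Rightarrow> real) \<Rightarrow> ('a \<Rightarrow> real) \<Rightarrow> bool" where
  "scheme_solution \<Omega> T m \<Delta>t u_old u \<longleftrightarrow>
     u \<in> V_h \<Omega> T \<and>
     (\<forall>v\<in>V_h \<Omega> T.
        mass_op T (\<lambda>x. (exp (u x) - exp (u_old x)) / \<Delta>t) v +
        stiffness_op T (\<lambda>x. m * exp (m * u_old x)) u v = 0)"

(* For d = 2: in a conforming triangulation of a planar domain, an edge lies on the boundary iff it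
   belongs to exactly one triangle. *)
definition boundary_edge :: "'a::euclidean_space set set \<Rightarrow> 'a set \<Rightarrow> bool" where
  "boundary_edge T E \<longleftrightarrow> card {K\<in>T. E edge_of K} = 1"

end

(* Test the scheme with the interpolant of the positive part (u - ln eps2)^+ of the vertex values. Every
   edge term of the stiffness operator is nonnegative, because the positive part is monotone and the
   edge weights are nonnegative; every term of the mass operator is nonnegative, and it is positive at a
   vertex where u > ln eps2 >= u_old. So u <= ln eps2 at all vertices, hence on all elements, and the
   lower bound follows in the same way from min (u - ln eps1) 0.

   The interpolant has to be in H1: for a piecewise affine f and a test function phi, f phi is
   Lipschitz with compact support, so dominated convergence of its difference quotients, whose
   integrals vanish by translation invariance, is integration by parts.

   For an interior edge pq in the plane with opposite vertices a and b, the Delaunay condition says that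
   b has nonnegative power with respect to the circumcircle of pqa, and the sum of the cotangents at a
   and b is this power divided by twice the area of pqb. *)
theory Submission
  imports Defs
begin

subsection \<open>Weak derivatives of piecewise affine functions\<close>

text \<open>Off the cover \<open>f\<close> is arbitrary, but there \<psi> vanishes. The zero set of
  \<psi> is closed and the product is constantly 0 on it, so it joins the cover and the pasting
  lemma for finitely many closed sets applies.\<close>

lemma continuous_on_mult_closed_cover:
  fixes f \<psi> :: "'a::euclidean_space \<Rightarrow> real"
  assumes "finite T" and "\<And>K. K \<in> T \<Longrightarrow> closed K" and "\<And>K. K \<in> T \<Longrightarrow> continuous_on K f"
    and \<psi>: "continuous_on UNIV \<psi>" and supp: "{x. \<psi> x \<noteq> 0} \<subseteq> \<Union>T"
  shows "continuous_on UNIV (\<lambda>x. f x * \<psi> x)"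
proof -
  let ?Z = "{x. \<psi> x = 0}"
  have "continuous_on (\<Union>K\<in>insert ?Z T. K) (\<lambda>x. f x * \<psi> x)"
  proof (rule continuous_on_closed_Union)
    show "finite (insert ?Z T)" using assms by simp
    have "closed ?Z"
      using \<psi> by (intro closed_Collect_eq continuous_intros)
    then show "\<And>K. K \<in> insert ?Z T \<Longrightarrow> closed K" using assms by auto
    show "continuous_on K (\<lambda>x. f x * \<psi> x)" if "K \<in> insert ?Z T" for K
    proof (cases "K \<in> T")
      case True
      then show ?thesis
        using assms continuous_on_subset[OF \<psi>, of K] by (auto intro!: continuous_intros)
    next
      case False
      then have "K = ?Z" using that by simp
      then show ?thesis
        using continuous_on_eq[of K "\<lambda>_. 0" "\<lambda>x. f x * \<psi> x"] by auto
    qed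
  qed
  moreover have "(\<Union>K\<in>insert ?Z T. K) = UNIV" using supp by auto
  ultimately show ?thesis by simp
qed

lemma test_function_directional:
  assumes "test_function \<Omega> \<phi>" and b: "b \<in> Basis"
  shows "continuous_on UNIV \<phi>"
    and "continuous_on UNIV (\<lambda>x. frechet_derivative \<phi> (at x) b)"
    and "((\<lambda>t. \<phi> (x + t *\<^sub>R b)) has_real_derivative frechet_derivative \<phi> (at (x + t *\<^sub>R b)) b) (at t)"
    and "frechet_derivative \<phi> (at x) b \<noteq> 0 \<Longrightarrow> x \<in> closure {x. \<phi> x \<noteq> 0}"
proof -
  have td: "times_differentiable k \<phi>" for k using assms by (simp add: test_function_def)
  show "continuous_on UNIV \<phi>" using td[of 0] by simp
  have diff: "\<phi> differentiable (at x)" for x using td[of 1] by simp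
  show "continuous_on UNIV (\<lambda>x. frechet_derivative \<phi> (at x) b)" using td[of 1] b by simp
  have "((\<lambda>t. \<phi> (x + t *\<^sub>R b)) has_derivative
      (\<lambda>s. frechet_derivative \<phi> (at (x + t *\<^sub>R b)) (s *\<^sub>R b))) (at t)"
  proof (rule has_derivative_compose[of "\<lambda>t. x + t *\<^sub>R b" "\<lambda>s. s *\<^sub>R b" t UNIV \<phi>])
    show "((\<lambda>t. x + t *\<^sub>R b) has_derivative (\<lambda>s. s *\<^sub>R b)) (at t)"
      by (auto intro!: derivative_eq_intros)
    show "(\<phi> has_derivative frechet_derivative \<phi> (at (x + t *\<^sub>R b))) (at (x + t *\<^sub>R b))"
      using diff frechet_derivative_works by blast
  qed
  moreover have "frechet_derivative \<phi> (at y) (s *\<^sub>R b) = frechet_derivative \<phi> (at y) b * s" for y s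
    using linear_frechet_derivative[OF diff] by (simp add: linear_cmul)
  ultimately show "((\<lambda>t. \<phi> (x + t *\<^sub>R b)) has_real_derivative frechet_derivative \<phi> (at (x + t *\<^sub>R b)) b) (at t)"
    by (simp add: has_field_derivative_def)
  show "x \<in> closure {x. \<phi> x \<noteq> 0}" if "frechet_derivative \<phi> (at x) b \<noteq> 0"
  proof (rule ccontr)
    assume x: "x \<notin> closure {x. \<phi> x \<noteq> 0}"
    have "(\<phi> has_derivative (\<lambda>_. 0)) (at x)"
    proof (rule has_derivative_transform_within_open[of "\<lambda>_. 0"])
      show "open (- closure {x. \<phi> x \<noteq> 0})" by auto
      show "\<And>y. y \<in> - closure {x. \<phi> x \<noteq> 0} \<Longrightarrow> 0 = \<phi> y"
        using closure_subset[of "{x. \<phi> x \<noteq> 0}"] by auto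
    qed (use x in auto)
    then have "frechet_derivative \<phi> (at x) = (\<lambda>_. 0)" by (rule frechet_derivative_at[symmetric])
    then show False using that by simp
  qed
qed

text \<open>The product may have kinks where elements meet, so the constant is found along lines:
  the part of a line inside one element is convex, the directional derivative is bounded there by
  compactness, and finitely many closed parts with the same Lipschitz constant glue
  together.\<close>

lemma piecewise_affine_mult_lipschitz:
  fixes f \<phi> :: "'a::euclidean_space \<Rightarrow> real"
  assumes fin: "finite T" and K: "\<And>K. K \<in> T \<Longrightarrow> compact K" "\<And>K. K \<in> T \<Longrightarrow> convex K"
    and f: "\<And>K x. K \<in> T \<Longrightarrow> x \<in> K \<Longrightarrow> f x = A K \<bullet> x + c K"
    and cov: "\<Omega> \<subseteq> \<Union>T" and \<phi>: "test_function \<Omega> \<phi>" and b: "b \<in> Basis"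
  obtains M where "0 \<le> M"
    and "\<And>x h. 0 \<le> h \<Longrightarrow> \<bar>f (x + h *\<^sub>R b) * \<phi> (x + h *\<^sub>R b) - f x * \<phi> x\<bar> \<le> M * h"
proof -
  define d where "d = (\<lambda>x. frechet_derivative \<phi> (at x) b)"
  note tf = test_function_directional[OF \<phi> b]
  have c\<phi>: "continuous_on S \<phi>" and cd: "continuous_on S d" for S
    using tf(1,2) continuous_on_subset unfolding d_def by blast+
  have "\<exists>m. \<forall>x\<in>K. \<bar>(A K \<bullet> b) * \<phi> x + (A K \<bullet> x + c K) * d x\<bar> \<le> m" if "K \<in> T" for K
  proof -
    have "compact ((\<lambda>x. (A K \<bullet> b) * \<phi> x + (A K \<bullet> x + c K) * d x) ` K)"
      by (intro compact_continuous_image continuous_intros K c\<phi> cd that)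
    then have "bounded ((\<lambda>x. (A K \<bullet> b) * \<phi> x + (A K \<bullet> x + c K) * d x) ` K)"
      by (rule compact_imp_bounded)
    then show ?thesis unfolding bounded_iff by auto
  qed
  then have "\<forall>K\<in>T. \<exists>m. \<forall>x\<in>K. \<bar>(A K \<bullet> b) * \<phi> x + (A K \<bullet> x + c K) * d x\<bar> \<le> m"
    by blast
  from bchoice[OF this] obtain m where m: "\<And>K x. K \<in> T \<Longrightarrow> x \<in> K \<Longrightarrow>
      \<bar>(A K \<bullet> b) * \<phi> x + (A K \<bullet> x + c K) * d x\<bar> \<le> m K" by blast
  \<comment> \<open>The sum of absolute values replaces a maximum over the elements; it is
    nonnegative also for empty \<open>T\<close>.\<close>
  define M where "M = (\<Sum>K\<in>T. \<bar>m K\<bar>)"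
  have M0: "0 \<le> M" by (simp add: M_def sum_nonneg)
  have mM: "m K \<le> M" if "K \<in> T" for K
    using member_le_sum[OF that, of "\<lambda>K. \<bar>m K\<bar>"] fin by (simp add: M_def)
  have "\<bar>f (x + h *\<^sub>R b) * \<phi> (x + h *\<^sub>R b) - f x * \<phi> x\<bar> \<le> M * h" if h: "0 \<le> h" for x h
  proof -
    define G where "G = (\<lambda>t. f (x + t *\<^sub>R b) * \<phi> (x + t *\<^sub>R b))"
    define U where "U = (\<lambda>K. {t::real. x + t *\<^sub>R b \<in> K})"
    define Z where "Z = {y. \<phi> y = 0}"
    have vim: "U S = (\<lambda>t. x + t *\<^sub>R b) -` S" for S by (auto simp: U_def)
    have closedU: "closed (U S)" if "closed S" for S
      unfolding vim by (intro continuous_closed_vimage that continuous_intros)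
    have clZ: "closed Z"
      unfolding Z_def by (intro closed_Collect_eq c\<phi> continuous_intros)
    \<comment> \<open>The zero set \<open>Z\<close> of \<phi> covers those parts of the line that
      lie outside all elements.\<close>
    have "lipschitz_on M {0..h} G"
    proof (rule lipschitz_on_closed_Union[of "insert Z T" _ U])
      show "finite (insert Z T)" "M \<ge> 0" using fin M0 by auto
      show "closed (U S)" if "S \<in> insert Z T" for S
        using that clZ K(1) compact_imp_closed closedU by blast
      show "{0..h} \<subseteq> \<Union> (U ` insert Z T)"
      proof
        fix t
        show "t \<in> \<Union> (U ` insert Z T)"
        proof (cases "\<phi> (x + t *\<^sub>R b) = 0")
          case True then show ?thesis by (auto simp: U_def Z_def)
        next
          case False
          then have "x + t *\<^sub>R b \<in> closure {x. \<phi> x \<noteq> 0}"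
            using closure_subset[of "{x. \<phi> x \<noteq> 0}"] by auto
          then have "x + t *\<^sub>R b \<in> \<Union>T" using \<phi> cov by (auto simp: test_function_def)
          then show ?thesis by (auto simp: U_def)
        qed
      qed
      show "lipschitz_on M (U S) G" if S: "S \<in> insert Z T" for S
      proof (cases "S \<in> T")
        case False
        then have "S = Z" using S by simp
        then have "G t = 0" if "t \<in> U S" for t using that by (auto simp: U_def Z_def G_def)
        then show ?thesis using M0 by (auto simp: lipschitz_on_def)
      next
        case True
        have cU: "convex (U S)"
        proof (rule convexI)
          fix s t u v :: real assume st: "s \<in> U S" "t \<in> U S" and uv: "0 \<le> u" "0 \<le> v" "u + v = 1"
          have "x + (u *\<^sub>R s + v *\<^sub>R t) *\<^sub>R b = u *\<^sub>R (x + s *\<^sub>R b) + v *\<^sub>R (x + t *\<^sub>R b)"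
          proof -
            have "x = u *\<^sub>R x + v *\<^sub>R x" using uv(3) by (metis scaleR_left_distrib scaleR_one)
            then show ?thesis by (simp add: scaleR_right_distrib scaleR_left_distrib)
          qed
          then show "u *\<^sub>R s + v *\<^sub>R t \<in> U S"
            using convexD[OF K(2)[OF True], of "x + s *\<^sub>R b" "x + t *\<^sub>R b" u v] st uv by (simp add: U_def)
        qed
        let ?L = "\<lambda>t. A S \<bullet> (x + t *\<^sub>R b) + c S"
        have "lipschitz_on M (U S) (\<lambda>t. ?L t * \<phi> (x + t *\<^sub>R b))"
        proof (rule bounded_derivative_imp_lipschitz[OF _ cU])
          fix t assume t: "t \<in> U S"
          let ?D = "(A S \<bullet> b) * \<phi> (x + t *\<^sub>R b) + ?L t * d (x + t *\<^sub>R b)"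
          have "((\<lambda>t. ?L t * \<phi> (x + t *\<^sub>R b)) has_real_derivative ?D) (at t)"
          proof -
            have "(?L has_real_derivative (A S \<bullet> b)) (at t)"
              by (auto simp: inner_add_right intro!: derivative_eq_intros)
            from DERIV_mult[OF this tf(3)[of x t]] show ?thesis
              unfolding d_def by (simp add: algebra_simps)
          qed
          then show "((\<lambda>t. ?L t * \<phi> (x + t *\<^sub>R b)) has_derivative (*) ?D) (at t within U S)"
            unfolding has_field_derivative_def by (rule has_derivative_at_withinI)
          have "\<bar>?D\<bar> \<le> M" using m[OF True, of "x + t *\<^sub>R b"] mM[OF True] t by (force simp: U_def)
          then show "onorm ((*) ?D) \<le> M"
            by (intro onorm_bound) (auto simp: M0 abs_mult mult_right_mono)
        qed (rule M0)
        moreover have "G t = ?L t * \<phi> (x + t *\<^sub>R b)" if "t \<in> U S" for t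
          using f[OF True] that by (simp add: G_def U_def)
        ultimately show ?thesis unfolding lipschitz_on_def by simp
      qed
    qed
    then have "dist (G h) (G 0) \<le> M * dist h 0" using h by (intro lipschitz_onD) auto
    then show ?thesis using h by (simp add: G_def dist_real_def)
  qed
  with M0 that show thesis by blast
qed

section \<open>Integration by parts through difference quotients\<close>

lemma integral_lborel_translate:
  fixes F :: "'a::euclidean_space \<Rightarrow> real"
  assumes "F \<in> borel_measurable borel"
  shows "integral\<^sup>L lborel (\<lambda>x. F (x + b)) = integral\<^sup>L lborel F"
proof -
  have "integral\<^sup>L lborel F = integral\<^sup>L (distr lborel borel ((+) b)) F"
    by (simp add: lborel_distr_plus)
  also have "\<dots> = integral\<^sup>L lborel (\<lambda>x. F (b + x))"
    by (rule integral_distr) (use assms in auto)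
  finally show ?thesis by (simp add: add.commute)
qed

lemma integrable_lborel_compact_support:
  fixes F :: "'a::euclidean_space \<Rightarrow> real"
  assumes "continuous_on UNIV F" and "compact S" and "{x. F x \<noteq> 0} \<subseteq> S"
  shows "integrable lborel F"
proof -
  have "integrable lborel (\<lambda>x. indicator S x *\<^sub>R F x)"
    by (rule borel_integrable_compact[OF assms(2)]) (use assms(1) continuous_on_subset in blast)
  moreover have "(\<lambda>x. indicator S x *\<^sub>R F x) = F"
    using assms(3) by (auto simp: indicator_def fun_eq_iff)
  ultimately show ?thesis by simp
qed

text \<open>The Lipschitz bound dominates difference quotients that all have integral 0.
  Differentiability is asked only almost everywhere, which admits kinks on the frontiers of
  elements.\<close>

lemma integral_difference_quotient_limit:
  fixes F g :: "'a::euclidean_space \<Rightarrow> real"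
  assumes F: "continuous_on UNIV F" and S: "compact S" "{x. F x \<noteq> 0} \<subseteq> S"
    and g: "g \<in> borel_measurable lborel"
    and lip: "\<And>x h. 0 \<le> h \<Longrightarrow> \<bar>F (x + h *\<^sub>R b) - F x\<bar> \<le> M * h" and b: "norm b = 1"
    and deriv: "AE x in lborel. ((\<lambda>t. F (x + t *\<^sub>R b)) has_real_derivative g x) (at 0)"
  shows "integrable lborel g" and "integral\<^sup>L lborel g = 0"
proof -
  define h where "h = (\<lambda>n::nat. 1 / real (Suc n))"
  define s where "s = (\<lambda>n x. (F (x + h n *\<^sub>R b) - F x) / h n)"
  have h: "0 < h n" "h n \<le> 1" for n by (auto simp: h_def)
  have Fb: "F \<in> borel_measurable borel" using F by (rule borel_measurable_continuous_onI)
  have FI: "integrable lborel F" by (rule integrable_lborel_compact_support[OF F S])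
  have s0: "integral\<^sup>L lborel (s n) = 0" for n
  proof -
    have "integrable lborel (\<lambda>x. F (x + h n *\<^sub>R b))"
    proof (rule integrable_lborel_compact_support)
      show "continuous_on UNIV (\<lambda>x. F (x + h n *\<^sub>R b))"
        by (rule continuous_on_compose2[OF F]) (auto intro!: continuous_intros)
      show "compact ((\<lambda>x. x - h n *\<^sub>R b) ` S)"
        by (intro compact_continuous_image continuous_intros S)
      show "{x. F (x + h n *\<^sub>R b) \<noteq> 0} \<subseteq> (\<lambda>x. x - h n *\<^sub>R b) ` S"
      proof
        fix x assume "x \<in> {x. F (x + h n *\<^sub>R b) \<noteq> 0}"
        then have "x + h n *\<^sub>R b \<in> S" using S(2) by auto
        then show "x \<in> (\<lambda>x. x - h n *\<^sub>R b) ` S" by (auto intro!: image_eqI[of _ _ "x + h n *\<^sub>R b"])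
      qed
    qed
    then show ?thesis
      using FI integral_lborel_translate[OF Fb, of "h n *\<^sub>R b"] by (simp add: s_def)
  qed
  obtain R where R: "\<And>x. x \<in> S \<Longrightarrow> norm x \<le> R"
    using compact_imp_bounded[OF S(1)] by (auto simp: bounded_iff)
  \<comment> \<open>\<open>R\<close> bounds the support and the shifts \<open>h n\<close> have
    length at most 1, so every quotient vanishes outside the ball of radius
    \<open>R + 1\<close>.\<close>
  define w where "w = (\<lambda>x::'a. M * indicator (cball 0 (R + 1)) x)"
  have wI: "integrable lborel w"
  proof -
    have "integrable lborel (\<lambda>x. indicator (cball 0 (R + 1)) x *\<^sub>R M)"
      by (rule borel_integrable_compact) (auto intro: continuous_intros)
    then show ?thesis by (simp add: w_def mult.commute)
  qed
  have bound: "norm (s n x) \<le> w x" for n x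
  proof (cases "x \<in> cball 0 (R + 1)")
    case True
    have "norm (s n x) = \<bar>F (x + h n *\<^sub>R b) - F x\<bar> / h n" using h[of n] by (simp add: s_def)
    also have "\<dots> \<le> M" using lip[of "h n" x] h[of n] by (simp add: divide_le_eq)
    finally show ?thesis using True by (simp add: w_def)
  next
    case False
    then have nx: "norm x > R + 1" by simp
    have "norm x \<le> norm (x + h n *\<^sub>R b) + norm (h n *\<^sub>R b)"
      using norm_triangle_ineq4[of "x + h n *\<^sub>R b" "h n *\<^sub>R b"] by simp
    then have "norm (x + h n *\<^sub>R b) > R" using nx h[of n] b by simp
    then have "F (x + h n *\<^sub>R b) = 0" "F x = 0" using R[of x] R[of "x + h n *\<^sub>R b"] nx S(2) by force+
    then show ?thesis using False by (simp add: s_def w_def)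
  qed
  have sM: "s n \<in> borel_measurable lborel" for n
  proof -
    have "continuous_on UNIV (s n)" unfolding s_def
      by (intro continuous_intros continuous_on_compose2[OF F]) (use h[of n] in auto)
    then show ?thesis by (simp add: borel_measurable_continuous_onI)
  qed
  have lim: "AE x in lborel. (\<lambda>n. s n x) \<longlonglongrightarrow> g x"
    using deriv
  proof eventually_elim
    case (elim x)
    have "h \<longlonglongrightarrow> 0" unfolding h_def using LIMSEQ_inverse_real_of_nat
      by (simp add: inverse_eq_divide)
    moreover have "h n \<noteq> 0" for n using h(1)[of n] by simp
    ultimately have h0: "filterlim h (at 0) sequentially" unfolding filterlim_at by simp
    have "(\<lambda>k. (F (x + k *\<^sub>R b) - F x) / k) \<midarrow>0\<rightarrow> g x"
      using elim by (simp add: DERIV_def)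
    from filterlim_compose[OF this h0] show ?case unfolding s_def .
  qed
  show "integrable lborel g"
    by (rule integrable_dominated_convergence[OF g sM wI lim]) (use bound in auto)
  have "(\<lambda>n. integral\<^sup>L lborel (s n)) \<longlonglongrightarrow> integral\<^sup>L lborel g"
    by (rule integral_dominated_convergence[OF g sM wI lim]) (use bound in auto)
  then show "integral\<^sup>L lborel g = 0" by (simp add: s0 LIMSEQ_const_iff)
qed

text \<open>The formula for \<open>f\<close> holds on every closed element containing the point, so
  the affine pieces agree on common faces and integration by parts leaves no jump terms. On
  frontiers nothing is prescribed for \<open>g\<close>: frontiers of convex sets are null.\<close>

lemma piecewise_affine_weak_partial:
  fixes f g :: "'a::euclidean_space \<Rightarrow> real"
  assumes fin: "finite T" and K: "\<And>K. K \<in> T \<Longrightarrow> compact K" "\<And>K. K \<in> T \<Longrightarrow> convex K"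
    and f: "\<And>K x. K \<in> T \<Longrightarrow> x \<in> K \<Longrightarrow> f x = A K \<bullet> x + c K"
    and g: "\<And>K x. K \<in> T \<Longrightarrow> x \<in> interior K \<Longrightarrow> g x = A K \<bullet> b"
    and gm: "g \<in> borel_measurable borel"
    and \<Omega>: "open \<Omega>" and cov: "\<Omega> \<subseteq> \<Union>T" and b: "b \<in> Basis"
  shows "weak_partial \<Omega> b f g"
  unfolding weak_partial_def
proof (intro allI impI)
  fix \<phi> assume \<phi>: "test_function \<Omega> \<phi>"
  define d where "d = (\<lambda>x. frechet_derivative \<phi> (at x) b)"
  define S where "S = closure {x. \<phi> x \<noteq> 0}"
  note tf = test_function_directional[OF \<phi> b, folded d_def S_def]
  have S: "compact S" "S \<subseteq> \<Omega>" using \<phi> by (auto simp: test_function_def S_def)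
  have supp: "\<phi> x = 0" "d x = 0" if "x \<notin> S" for x
    using that tf(4)[of x] closure_subset[of "{x. \<phi> x \<noteq> 0}"] by (auto simp: S_def d_def)
  have fK: "continuous_on K f" if "K \<in> T" for K
  proof -
    have "continuous_on K (\<lambda>x. A K \<bullet> x + c K)" by (intro continuous_intros)
    then show ?thesis using f[OF that] by (simp cong: continuous_on_cong)
  qed
  have SU: "{x. \<phi> x \<noteq> 0} \<subseteq> \<Union>T" "{x. d x \<noteq> 0} \<subseteq> \<Union>T"
  proof -
    have "{x. \<phi> x \<noteq> 0} \<subseteq> S" "{x. d x \<noteq> 0} \<subseteq> S" using supp by blast+
    then show "{x. \<phi> x \<noteq> 0} \<subseteq> \<Union>T" "{x. d x \<noteq> 0} \<subseteq> \<Union>T" using S cov by auto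
  qed
  have cl: "closed K" if "K \<in> T" for K using K(1)[OF that] by (rule compact_imp_closed)
  have F: "continuous_on UNIV (\<lambda>x. f x * \<phi> x)"
    by (rule continuous_on_mult_closed_cover[OF fin cl fK tf(1) SU(1)])
  have Fd: "continuous_on UNIV (\<lambda>x. f x * d x)"
    by (rule continuous_on_mult_closed_cover[OF fin cl fK tf(2)[folded d_def] SU(2)])
  have dI: "integrable lborel (\<lambda>x. f x * d x)"
    by (rule integrable_lborel_compact_support[OF Fd S(1)]) (use supp in auto)
  obtain M where "0 \<le> M" and lip: "\<And>x h. 0 \<le> h \<Longrightarrow> \<bar>f (x + h *\<^sub>R b) * \<phi> (x + h *\<^sub>R b) - f x * \<phi> x\<bar> \<le> M * h"
    by (rule piecewise_affine_mult_lipschitz[where f=f and A=A and c=c, OF fin K f cov \<phi> b]) auto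
  have "AE x in lborel. ((\<lambda>t. f (x + t *\<^sub>R b) * \<phi> (x + t *\<^sub>R b)) has_real_derivative
      (g x * \<phi> x + f x * d x)) (at 0)"
  proof -
    have "AE x in lebesgue. \<forall>K\<in>T. x \<notin> frontier K"
    proof (rule AE_finite_allI[OF fin])
      fix K assume "K \<in> T"
      then have "negligible (frontier K)" using K by (intro negligible_convex_frontier)
      then have "frontier K \<in> null_sets lebesgue" by (simp add: negligible_iff_null_sets)
      then show "AE x in lebesgue. x \<notin> frontier K" by (rule AE_not_in)
    qed
    then have "AE x in lborel. \<forall>K\<in>T. x \<notin> frontier K" by (simp add: AE_completion_iff)
    then show ?thesis
    proof eventually_elim
      case (elim x)
      show ?case
      proof (cases "\<exists>K\<in>T. x \<in> K")
        case True
        then obtain K where K': "K \<in> T" "x \<in> K" by blast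
        then have xi: "x \<in> interior K"
          using elim closure_subset by (auto simp: frontier_def)
        have "((\<lambda>t. A K \<bullet> (x + t *\<^sub>R b) + c K) has_real_derivative (A K \<bullet> b)) (at 0)"
          by (auto simp: inner_add_right intro!: derivative_eq_intros)
        from DERIV_mult[OF this tf(3)[of x 0]]
        have "((\<lambda>t. (A K \<bullet> (x + t *\<^sub>R b) + c K) * \<phi> (x + t *\<^sub>R b)) has_real_derivative
            (g x * \<phi> x + f x * d x)) (at 0)"
          using g[OF K'(1) xi] f[OF K'] by (simp add: d_def algebra_simps)
        then show ?thesis
        proof (rule has_field_derivative_transform_within_open)
          show "open {t. x + t *\<^sub>R b \<in> interior K}"
            using continuous_open_vimage[of "interior K" "\<lambda>t. x + t *\<^sub>R b"]
            by (simp add: vimage_def)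
          show "0 \<in> {t. x + t *\<^sub>R b \<in> interior K}" using xi by simp
          show "\<And>t. t \<in> {t. x + t *\<^sub>R b \<in> interior K} \<Longrightarrow>
              (A K \<bullet> (x + t *\<^sub>R b) + c K) * \<phi> (x + t *\<^sub>R b) = f (x + t *\<^sub>R b) * \<phi> (x + t *\<^sub>R b)"
            using f[OF K'(1)] interior_subset by (metis mem_Collect_eq subsetD)
        qed
      next
        \<comment> \<open>Outside all elements the point lies off the closed support
          \<open>S\<close>, so the product is 0 in a neighbourhood.\<close>
        case False
        then have xS: "x \<notin> S" using S cov by auto
        have "((\<lambda>t. f (x + t *\<^sub>R b) * \<phi> (x + t *\<^sub>R b)) has_real_derivative 0) (at 0)"
        proof (rule has_field_derivative_transform_within_open[where f="\<lambda>_. 0"])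
          show "open {t. x + t *\<^sub>R b \<in> - S}"
            using continuous_open_vimage[of "- S" "\<lambda>t. x + t *\<^sub>R b"] compact_imp_closed[OF S(1)]
            by (simp add: vimage_def open_Compl)
          show "0 \<in> {t. x + t *\<^sub>R b \<in> - S}" using xS by simp
        qed (use supp in auto)
        then show ?thesis using supp[OF xS] by simp
      qed
    qed
  qed
  moreover have "(\<lambda>x. g x * \<phi> x + f x * d x) \<in> borel_measurable lborel"
    using gm borel_measurable_continuous_onI[OF tf(1)] borel_measurable_continuous_onI[OF Fd] by simp
  ultimately have I: "integrable lborel (\<lambda>x. g x * \<phi> x + f x * d x)"
      "integral\<^sup>L lborel (\<lambda>x. g x * \<phi> x + f x * d x) = 0"
    using integral_difference_quotient_limit[OF F S(1), of "\<lambda>x. g x * \<phi> x + f x * d x" b M]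
      lip supp b by (auto simp: subset_iff)
  have gI: "integrable lborel (\<lambda>x. g x * \<phi> x)"
    using Bochner_Integration.integrable_diff[OF I(1) dI] by simp
  \<comment> \<open>Both integrands vanish off \<open>S\<close>, which lies in \<Omega>, so the
    integral over \<Omega> is one over the whole space; \<open>integral_completion\<close> then
    replaces \<open>lebesgue\<close> by \<open>lborel\<close>.\<close>
  have restr: "integral\<^sup>L (lebesgue_on \<Omega>) (\<lambda>x. G x * \<psi> x) = integral\<^sup>L lborel (\<lambda>x. G x * \<psi> x)"
    if "integrable lborel (\<lambda>x. G x * \<psi> x)" "\<And>x. x \<notin> S \<Longrightarrow> \<psi> x = 0" for G \<psi> :: "'a \<Rightarrow> real"
  proof -
    have "integral\<^sup>L (lebesgue_on \<Omega>) (\<lambda>x. G x * \<psi> x) =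
        integral\<^sup>L lebesgue (\<lambda>x. indicator \<Omega> x *\<^sub>R (G x * \<psi> x))"
      by (rule integral_restrict_space) (use \<Omega> in auto)
    also have "(\<lambda>x. indicator \<Omega> x *\<^sub>R (G x * \<psi> x)) = (\<lambda>x. G x * \<psi> x)"
      using that(2) S(2) by (auto simp: indicator_def fun_eq_iff)
    finally show ?thesis
      using that(1) by (simp add: integral_completion)
  qed
  have "integral\<^sup>L lborel (\<lambda>x. g x * \<phi> x) + integral\<^sup>L lborel (\<lambda>x. f x * d x) = 0"
    using I(2) gI dI by simp
  then show "integral\<^sup>L (lebesgue_on \<Omega>) (\<lambda>x. f x * frechet_derivative \<phi> (at x) b) =
      - integral\<^sup>L (lebesgue_on \<Omega>) (\<lambda>x. g x * \<phi> x)"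
    using restr[OF gI supp(1)] restr[OF dI supp(2)] by (simp add: d_def)
qed

subsection \<open>Nodal interpolation\<close>

lemma simplex_verts:
  assumes "n simplex K"
  obtains "\<not> affine_dependent (verts K)" and "int (card (verts K)) = n + 1"
    and "K = convex hull (verts K)" and "finite (verts K)"
proof -
  obtain C where C: "\<not> affine_dependent C" "int (card C) = n + 1" "K = convex hull C"
    using assms by (auto simp: simplex_def)
  then have "verts K = C"
    using extreme_point_of_convex_hull_affine_independent[of C] by (auto simp: verts_def)
  then show thesis using that C aff_independent_finite by auto
qed

lemma simplicial_mesh_element:
  fixes T :: "'a::euclidean_space set set"
  assumes "simplicial_mesh \<Omega> T" and "K \<in> T"
  shows "\<not> affine_dependent (verts K)" and "card (verts K) = DIM('a) + 1"
    and "convex hull (verts K) = K" and "finite (verts K)" and "compact K" and "convex K"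
    and "interior K \<noteq> {}" and "polytope K"
proof -
  have "int DIM('a) simplex K" using assms by (auto simp: simplicial_mesh_def)
  then show d: "\<not> affine_dependent (verts K)" and n: "card (verts K) = DIM('a) + 1"
    and h: "convex hull (verts K) = K" and f: "finite (verts K)"
    by (auto elim!: simplex_verts)
  show "polytope K" using h f unfolding polytope_def by metis
  then show "compact K" "convex K" by (auto intro: polytope_imp_compact polytope_imp_convex)
  have "affine hull K = UNIV"
    using aff_dim_simplex[OF \<open>int DIM('a) simplex K\<close>] aff_dim_eq_full by blast
  then have "interior K = rel_interior K" by (simp add: rel_interior_interior)
  moreover have "K \<noteq> {}" using n h by force
  ultimately show "interior K \<noteq> {}" using \<open>convex K\<close> by (simp add: rel_interior_eq_empty)
qed

text \<open>A face that meets the interior of a convex set is the whole set. Applied in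
  \<open>K\<close> this puts \<open>K\<close> inside \<open>L\<close>, so \<open>x\<close> is
  interior to \<open>L\<close> too, and the same argument in \<open>L\<close> gives
  equality.\<close>

lemma mesh_interior_disjoint:
  assumes "triangulation T" and "K \<in> T" and "L \<in> T" and "x \<in> interior K" and "x \<in> L"
  shows "K = L"
proof -
  have f: "K \<inter> L face_of K" "L \<inter> K face_of L" using assms by (auto simp: triangulation_def)
  have "x \<in> K" using assms(4) interior_subset by blast
  then have "K \<inter> L = K" using face_of_disjoint_interior[OF f(1)] assms by blast
  then have "x \<in> interior L" using assms(4) interior_mono[of K L] by blast
  then have "L \<inter> K = L" using face_of_disjoint_interior[OF f(2)] \<open>x \<in> K\<close> assms(5) by blast
  with \<open>K \<inter> L = K\<close> show ?thesis by blast
qed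

section \<open>Piecewise affine functions as members of the finite element space\<close>

lemma P1_continuous_on: "f \<in> P1_on K \<Longrightarrow> continuous_on K f"
proof -
  assume "f \<in> P1_on K"
  then obtain a b where "\<forall>x\<in>K. f x = a \<bullet> x + b" by (auto simp: P1_on_def)
  moreover have "continuous_on K (\<lambda>x. a \<bullet> x + b)" by (intro continuous_intros)
  ultimately show ?thesis by (simp cong: continuous_on_cong)
qed

lemma piecewise_P1_continuous_on:
  assumes "simplicial_mesh \<Omega> T" and "\<forall>K\<in>T. f \<in> P1_on K"
  shows "continuous_on (closure \<Omega>) f"
proof -
  have "continuous_on (\<Union>K\<in>T. K) f"
    using assms simplicial_mesh_element(5)[OF assms(1)]
    by (intro continuous_on_closed_Union P1_continuous_on)
       (auto simp: simplicial_mesh_def triangulation_def compact_imp_closed)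
  then show ?thesis using assms(1) by (simp add: simplicial_mesh_def)
qed

lemma bounded_measurable_in_L2:
  fixes f :: "'a::euclidean_space \<Rightarrow> real"
  assumes "open \<Omega>" and "bounded \<Omega>" and "f \<in> borel_measurable (lebesgue_on \<Omega>)"
    and "\<And>x. x \<in> \<Omega> \<Longrightarrow> \<bar>f x\<bar> \<le> M"
  shows "f \<in> L2 \<Omega>"
proof -
  have fin: "finite_measure (lebesgue_on \<Omega>)"
    using assms(1,2) emeasure_bounded_finite[of \<Omega>]
    by (intro finite_measureI) (simp add: emeasure_restrict_space less_top)
  have "integrable (lebesgue_on \<Omega>) (\<lambda>x. (f x)\<^sup>2)"
  proof (rule finite_measure.integrable_const_bound[OF fin])
    show "AE x in lebesgue_on \<Omega>. norm ((f x)\<^sup>2) \<le> M\<^sup>2"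
      by (rule AE_I2) (use assms(4) in \<open>auto simp: abs_le_square_iff[symmetric] intro: order_trans abs_ge_self\<close>)
  qed (use assms(3) in measurable)
  then show ?thesis using assms(3) by (simp add: L2_def)
qed

text \<open>Affine pieces on closed elements already force continuity, and the finitely many slopes
  are bounded on a bounded domain; together this yields the Sobolev condition.\<close>

lemma piecewise_P1_in_V_h:
  fixes f :: "'a::euclidean_space \<Rightarrow> real"
  assumes \<Omega>: "open \<Omega>" "bounded \<Omega>" and mesh: "simplicial_mesh \<Omega> T"
    and f: "\<forall>K\<in>T. f \<in> P1_on K"
  shows "f \<in> V_h \<Omega> T"
proof -
  have tri: "triangulation T" and fin: "finite T" and cov: "\<Omega> \<subseteq> \<Union>T"
    using mesh closure_subset by (auto simp: simplicial_mesh_def triangulation_def)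
  note el = simplicial_mesh_element[OF mesh]
  have "\<forall>K\<in>T. \<exists>a. \<exists>b. \<forall>x\<in>K. f x = a \<bullet> x + b" using f by (auto simp: P1_on_def)
  from bchoice[OF this] obtain A where "\<forall>K\<in>T. \<exists>b. \<forall>x\<in>K. f x = A K \<bullet> x + b" by blast
  from bchoice[OF this] obtain c where A: "\<And>K x. K \<in> T \<Longrightarrow> x \<in> K \<Longrightarrow> f x = A K \<bullet> x + c K" by blast
  have cont: "continuous_on (closure \<Omega>) f" by (rule piecewise_P1_continuous_on[OF mesh f])
  have "compact (closure \<Omega>)" using \<Omega> by (simp add: compact_closure)
  then have "bounded (f ` closure \<Omega>)" using cont by (intro compact_imp_bounded compact_continuous_image)
  then obtain M where M: "\<And>x. x \<in> closure \<Omega> \<Longrightarrow> \<bar>f x\<bar> \<le> M" by (auto simp: bounded_iff)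
  have "f \<in> L2 \<Omega>"
  proof (rule bounded_measurable_in_L2[OF \<Omega>])
    have "continuous_on \<Omega> f" using cont closure_subset continuous_on_subset by blast
    then show "f \<in> borel_measurable (lebesgue_on \<Omega>)"
      by (rule continuous_imp_measurable_on_sets_lebesgue) (use \<Omega> in auto)
    show "\<bar>f x\<bar> \<le> M" if "x \<in> \<Omega>" for x using M[of x] that closure_subset by blast
  qed
  moreover have "\<exists>g\<in>L2 \<Omega>. weak_partial \<Omega> b f g" if b: "b \<in> Basis" for b
  proof
    \<comment> \<open>The elementwise slope, set to 0 on frontiers. At an interior point of an
      element only its own term survives, since no other element contains that point.\<close>
    let ?g = "\<lambda>x. \<Sum>K\<in>T. indicator (interior K) x * (A K \<bullet> b)"
    have gm: "?g \<in> borel_measurable borel" by measurable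
    show "?g \<in> L2 \<Omega>"
    proof (rule bounded_measurable_in_L2[OF \<Omega>])
      show "?g \<in> borel_measurable (lebesgue_on \<Omega>)"
        by (intro measurable_restrict_space1 measurable_completion) (use gm in simp)
      show "\<bar>?g x\<bar> \<le> (\<Sum>K\<in>T. \<bar>A K \<bullet> b\<bar>)" for x
        by (rule order_trans[OF sum_abs sum_mono]) (auto simp: indicator_def)
    qed
    show "weak_partial \<Omega> b f ?g"
    proof (rule piecewise_affine_weak_partial[where T=T and A=A and c=c])
      show "?g x = A K \<bullet> b" if "K \<in> T" "x \<in> interior K" for K x
      proof -
        have "indicator (interior L) x * (A L \<bullet> b) = (if L = K then A K \<bullet> b else 0)" if "L \<in> T" for L
        proof (cases "x \<in> interior L")
          case True
          then have "K = L"
            using mesh_interior_disjoint[OF tri \<open>K \<in> T\<close> that \<open>x \<in> interior K\<close>] interior_subset by blast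
          then show ?thesis using True by simp
        next
          case False
          then show ?thesis using \<open>x \<in> interior K\<close> by auto
        qed
        then have "?g x = (\<Sum>L\<in>T. if L = K then A K \<bullet> b else 0)" by (intro sum.cong) auto
        also have "\<dots> = A K \<bullet> b" using fin that by simp
        finally show ?thesis .
      qed
    qed (fact fin el(5) el(6) A gm \<Omega>(1) cov b)+
  qed
  ultimately show ?thesis using f by (simp add: V_h_def H1_def)
qed

section \<open>Interpolation of arbitrary vertex values\<close>

lemma affine_interpolation:
  fixes S :: "'a::euclidean_space set" and w :: "'a \<Rightarrow> real"
  assumes "\<not> affine_dependent S"
  obtains a c where "\<And>x. x \<in> S \<Longrightarrow> a \<bullet> x + c = w x"
proof (cases "S = {}")
  case True then show thesis using that by auto
next
  case False
  then obtain v where v: "v \<in> S" by blast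
  let ?B = "(\<lambda>x. x - v) ` (S - {v})"
  \<comment> \<open>Affine independence of \<open>S\<close> is linear independence of the
    differences from one vertex, so a linear functional can be given arbitrary increments on
    them.\<close>
  have "independent ?B"
    using assms v affine_dependent_iff_dependent2[of v S] by (simp add: image_def Setcompr_eq_image)
  then obtain g :: "'a \<Rightarrow> real" where g: "linear g" "\<And>y. y \<in> ?B \<Longrightarrow> g y = w (y + v) - w v"
    using linear_independent_extend[of ?B "\<lambda>y. w (y + v) - w v"] by blast
  \<comment> \<open>The adjoint at 1 is the vector that represents the functional \<open>g\<close>
    through the inner product.\<close>
  define a where "a = adjoint g (1::real)"
  have ga: "g y = a \<bullet> y" for y
    using adjoint_works[OF g(1), of y 1] by (simp add: a_def inner_commute)
  show thesis
  proof (rule that[of a "w v - a \<bullet> v"])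
    fix x assume "x \<in> S"
    then show "a \<bullet> x + (w v - a \<bullet> v) = w x"
    proof (cases "x = v")
      case False
      then have "g (x - v) = w x - w v" using g(2)[of "x - v"] \<open>x \<in> S\<close> by simp
      then show ?thesis by (simp add: ga inner_diff_right)
    qed simp
  qed
qed

lemma affine_eq_on_convex_hull:
  fixes a a' :: "'a::euclidean_space"
  assumes "\<And>x. x \<in> S \<Longrightarrow> a \<bullet> x + c = a' \<bullet> x + c'" and "x \<in> convex hull S"
  shows "a \<bullet> x + c = a' \<bullet> x + c'"
proof -
  have "convex {x. (a - a') \<bullet> x = c' - c}" by (rule convex_hyperplane)
  then have "convex hull S \<subseteq> {x. (a - a') \<bullet> x = c' - c}"
    using assms(1) by (intro hull_minimal) (auto simp: inner_diff_left algebra_simps)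
  then show ?thesis using assms(2) by (auto simp: inner_diff_left algebra_simps)
qed

text \<open>Krein-Milman applied to the face itself. It reduces the comparison of affine functions
  on a common face of two elements to their values at common vertices.\<close>

lemma mesh_face_verts:
  assumes mesh: "simplicial_mesh \<Omega> T" and "K \<in> T" and "F face_of K"
  shows "F = convex hull (verts F)" and "verts F \<subseteq> verts K"
proof -
  have "compact F" "convex F"
    using face_of_imp_compact face_of_imp_convex simplicial_mesh_element(5,6)[OF assms(1,2)] assms(3) by blast+
  then show "F = convex hull (verts F)" unfolding verts_def by (rule Krein_Milman_Minkowski)
  show "verts F \<subseteq> verts K" using extreme_point_of_face[OF assms(3)] by (auto simp: verts_def)
qed

text \<open>Each element has an affine interpolant of its own. By conformity two elements meet in a
  face of both, whose vertices are vertices of both, so their interpolants coincide there.\<close>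

lemma mesh_interpolant:
  fixes w :: "'a::euclidean_space \<Rightarrow> real"
  assumes \<Omega>: "open \<Omega>" "bounded \<Omega>" and mesh: "simplicial_mesh \<Omega> T"
  obtains f where "f \<in> V_h \<Omega> T" and "\<And>v. v \<in> mesh_verts T \<Longrightarrow> f v = w v"
proof -
  note el = simplicial_mesh_element(1)[OF mesh]
  have triD: "K \<inter> L face_of K" if "K \<in> T" "L \<in> T" for K L
    using mesh that by (simp add: simplicial_mesh_def triangulation_def)
  have "\<forall>K\<in>T. \<exists>a. \<exists>c. \<forall>x\<in>verts K. a \<bullet> x + c = w x"
  proof
    fix K assume "K \<in> T"
    then obtain a c where "\<And>x. x \<in> verts K \<Longrightarrow> a \<bullet> x + c = w x"
      using affine_interpolation[OF el] by metis
    then show "\<exists>a. \<exists>c. \<forall>x\<in>verts K. a \<bullet> x + c = w x" by blast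
  qed
  from bchoice[OF this] obtain A where "\<forall>K\<in>T. \<exists>c. \<forall>x\<in>verts K. A K \<bullet> x + c = w x" by blast
  from bchoice[OF this] obtain c
    where A: "\<And>K x. K \<in> T \<Longrightarrow> x \<in> verts K \<Longrightarrow> A K \<bullet> x + c K = w x" by blast
  have agree: "A K \<bullet> x + c K = A L \<bullet> x + c L" if "K \<in> T" "L \<in> T" "x \<in> K" "x \<in> L" for K L x
  proof (rule affine_eq_on_convex_hull)
    have F: "K \<inter> L face_of K" "K \<inter> L face_of L"
      using triD that Int_commute[of K L] by metis+
    show "x \<in> convex hull (verts (K \<inter> L))"
      using mesh_face_verts(1)[OF mesh that(1) F(1)] that by auto
    show "A K \<bullet> y + c K = A L \<bullet> y + c L" if y: "y \<in> verts (K \<inter> L)" for y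
    proof -
      have "y \<in> verts K" "y \<in> verts L"
        using y mesh_face_verts(2)[OF mesh \<open>K \<in> T\<close> F(1)] mesh_face_verts(2)[OF mesh \<open>L \<in> T\<close> F(2)]
        by blast+
      then show ?thesis using A \<open>K \<in> T\<close> \<open>L \<in> T\<close> by simp
    qed
  qed
  \<comment> \<open>By \<open>agree\<close> the value is independent of which element containing
    \<open>x\<close> is chosen.\<close>
  define f where "f = (\<lambda>x. let K = SOME K. K \<in> T \<and> x \<in> K in A K \<bullet> x + c K)"
  have f: "f x = A K \<bullet> x + c K" if "K \<in> T" "x \<in> K" for K x
  proof -
    have "(SOME L. L \<in> T \<and> x \<in> L) \<in> T \<and> x \<in> (SOME L. L \<in> T \<and> x \<in> L)"
      using someI[of "\<lambda>L. L \<in> T \<and> x \<in> L" K] that by blast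
    then show ?thesis unfolding f_def Let_def using agree that by blast
  qed
  have "f \<in> V_h \<Omega> T"
  proof (rule piecewise_P1_in_V_h[OF \<Omega> mesh])
    show "\<forall>K\<in>T. f \<in> P1_on K" unfolding P1_on_def using f by blast
  qed
  moreover have "f v = w v" if v: "v \<in> mesh_verts T" for v
  proof -
    obtain K where K: "K \<in> T" "v \<in> verts K" using v by (auto simp: mesh_verts_def)
    then have "v \<in> K" by (auto simp: verts_def extreme_point_of_def)
    then show ?thesis using f[OF K(1)] A[OF K] by simp
  qed
  ultimately show thesis using that by blast
qed

subsection \<open>Cotangent weights in the plane\<close>

text \<open>The two-dimensional determinant in the coordinates of an arbitrary basis enumeration; only its
  square and products of two values are independent of that choice. It is meaningless unless the
  dimension is two.\<close>
definition cross2 :: "'a::euclidean_space \<Rightarrow> 'a \<Rightarrow> real" where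
  "cross2 x y = (let (e, f) = (SOME (e, f). e \<noteq> f \<and> Basis = {e, f :: 'a})
                 in (x \<bullet> e) * (y \<bullet> f) - (x \<bullet> f) * (y \<bullet> e))"

lemma cross2_coordinates:
  assumes "DIM('a) = 2"
  obtains e f :: "'a::euclidean_space" where "e \<noteq> f" and "Basis = {e, f}"
    and "\<And>x y. cross2 x y = (x \<bullet> e) * (y \<bullet> f) - (x \<bullet> f) * (y \<bullet> e)"
    and "\<And>x y. x \<bullet> y = (x \<bullet> e) * (y \<bullet> e) + (x \<bullet> f) * (y \<bullet> f)"
proof -
  obtain e0 f0 :: 'a where "e0 \<noteq> f0" "Basis = {e0, f0}"
    using assms by (auto simp: card_2_iff)
  then have ex: "(\<lambda>(e, f). e \<noteq> f \<and> Basis = {e, f :: 'a}) (e0, f0)" by simp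
  define ef where "ef = (SOME (e, f). e \<noteq> f \<and> Basis = {e, f :: 'a})"
  have ef: "fst ef \<noteq> snd ef" "Basis = {fst ef, snd ef}"
    using someI[of "\<lambda>(e, f). e \<noteq> f \<and> Basis = {e, f :: 'a}", OF ex] unfolding ef_def
    by (simp_all add: case_prod_beta)
  show thesis
  proof (rule that[OF ef])
    show "cross2 x y = (x \<bullet> fst ef) * (y \<bullet> snd ef) - (x \<bullet> snd ef) * (y \<bullet> fst ef)" for x y
      by (simp add: cross2_def ef_def[symmetric] case_prod_beta)
    show "x \<bullet> y = (x \<bullet> fst ef) * (y \<bullet> fst ef) + (x \<bullet> snd ef) * (y \<bullet> snd ef)" for x y :: 'a
    proof -
      have "x \<bullet> y = (\<Sum>b\<in>{fst ef, snd ef}. (x \<bullet> b) * (y \<bullet> b))"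
        using euclidean_inner[of x y] ef(2) by simp
      then show ?thesis using ef(1) by simp
    qed
  qed
qed

text \<open>Lagrange's identity in the plane, checked in coordinates.\<close>

lemma cross2_square:
  fixes x y :: "'a::euclidean_space"
  assumes "DIM('a) = 2"
  shows "(cross2 x y)\<^sup>2 = (norm x * norm y)\<^sup>2 - (x \<bullet> y)\<^sup>2"
proof -
  obtain e f :: 'a where c: "\<And>x y. cross2 x y = (x \<bullet> e) * (y \<bullet> f) - (x \<bullet> f) * (y \<bullet> e)"
    and i: "\<And>x y. x \<bullet> y = (x \<bullet> e) * (y \<bullet> e) + (x \<bullet> f) * (y \<bullet> f)"
    using cross2_coordinates[OF assms] by metis
  have "(norm x * norm y)\<^sup>2 = (x \<bullet> x) * (y \<bullet> y)"
    by (simp add: power_mult_distrib dot_square_norm)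
  then show ?thesis
    unfolding c i[of x x] i[of y y] i[of x y] by (simp add: power2_eq_square algebra_simps)
qed

text \<open>The sine of the angle comes from \<open>sin_arccos\<close> and Lagrange's identity. For
  parallel vectors both sides are divisions by 0 and hence 0.\<close>

lemma cot_vec_angle:
  fixes x y :: "'a::euclidean_space"
  assumes "DIM('a) = 2" and "x \<noteq> 0" and "y \<noteq> 0"
  shows "cot (vec_angle x y) = (x \<bullet> y) / \<bar>cross2 x y\<bar>"
proof -
  let ?n = "norm x * norm y" and ?r = "x \<bullet> y / (norm x * norm y)"
  have n: "?n > 0" using assms by simp
  have "\<bar>x \<bullet> y\<bar> \<le> ?n" by (rule Cauchy_Schwarz_ineq2)
  then have r: "-1 \<le> ?r" "?r \<le> 1" using n by (auto simp: divide_le_eq le_divide_eq abs_le_iff)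
  have "sin (arccos ?r) = sqrt (1 - ?r\<^sup>2)" using r by (rule sin_arccos)
  also have "1 - ?r\<^sup>2 = (cross2 x y / ?n)\<^sup>2"
    using assms(2,3) cross2_square[OF assms(1), of x y] by (simp add: power_divide diff_divide_distrib)
  also have "sqrt \<dots> = \<bar>cross2 x y\<bar> / ?n" using n by simp
  finally have "sin (vec_angle x y) = \<bar>cross2 x y\<bar> / ?n" by (simp add: vec_angle_def)
  moreover have "cos (vec_angle x y) = ?r" using r by (simp add: vec_angle_def cos_arccos)
  ultimately show ?thesis using n by (simp add: cot_def)
qed

text \<open>The difference between (p - x) . (q - x) and the power of x with respect to a circle
  through p and q is an affine function of x that vanishes on the line pq, hence a multiple of the
  determinant; the multiple is the cotangent of the inscribed angle.\<close>
lemma opposite_angles_cot_sum_nonneg: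
  fixes p q a b c :: "'a::euclidean_space"
  assumes dim: "DIM('a) = 2"
    and on: "p \<in> sphere c r" "q \<in> sphere c r" "a \<in> sphere c r" and off: "b \<notin> ball c r"
    and opp: "cross2 (p - a) (q - a) * cross2 (p - b) (q - b) < 0"
  shows "0 \<le> ((p - a) \<bullet> (q - a)) / \<bar>cross2 (p - a) (q - a)\<bar> + ((p - b) \<bullet> (q - b)) / \<bar>cross2 (p - b) (q - b)\<bar>"
proof -
  obtain e f :: 'a where cr: "\<And>x y. cross2 x y = (x \<bullet> e) * (y \<bullet> f) - (x \<bullet> f) * (y \<bullet> e)"
    and i: "\<And>x y. x \<bullet> y = (x \<bullet> e) * (y \<bullet> e) + (x \<bullet> f) * (y \<bullet> f)"
    using cross2_coordinates[OF dim] by metis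
  define N where "N = (\<lambda>x. (p - x) \<bullet> (q - x))"
  define D where "D = (\<lambda>x. cross2 (p - x) (q - x))"
  \<comment> \<open>\<open>pow\<close> is the power of a point with respect to the circle; the
    quotient \<open>k / l\<close> of the next two constants is, up to sign, the cotangent of the
    inscribed angle.\<close>
  define pow where "pow = (\<lambda>x. (x - c) \<bullet> (x - c) - r\<^sup>2)"
  define l where "l = (q - p) \<bullet> (q - p)"
  define k where "k = - cross2 (q - p) ((p - c) + (q - c))"
  have sph: "(x - c) \<bullet> (x - c) = r\<^sup>2" if "x \<in> sphere c r" for x
    using that by (simp add: dist_norm norm_minus_commute flip: power2_norm_eq_inner)
  have b: "0 \<le> pow b"
  proof -
    have "r \<le> norm (b - c)" and "0 \<le> r" using off on(1) by (auto simp: dist_norm norm_minus_commute)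
    then have "r\<^sup>2 \<le> (norm (b - c))\<^sup>2" by (intro power_mono)
    then show ?thesis by (simp add: pow_def power2_norm_eq_inner)
  qed
  have a: "pow a = 0" using sph[OF on(3)] by (simp add: pow_def)
  have Nx: "l * (N x - pow x) = k * D x" for x
  proof -
    define p1 p2 q1 q2 x1 x2 where "p1 = (p - c) \<bullet> e" "p2 = (p - c) \<bullet> f" "q1 = (q - c) \<bullet> e" "q2 = (q - c) \<bullet> f"
      "x1 = (x - c) \<bullet> e" "x2 = (x - c) \<bullet> f"
    note defs = this
    have P: "p1 * p1 + p2 * p2 = r\<^sup>2" and Q: "q1 * q1 + q2 * q2 = r\<^sup>2"
      using sph[OF on(1)] sph[OF on(2)] i[of "p - c" "p - c"] i[of "q - c" "q - c"]
      unfolding defs by linarith+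
    have d: "(p - x) \<bullet> e = p1 - x1" "(p - x) \<bullet> f = p2 - x2" "(q - x) \<bullet> e = q1 - x1" "(q - x) \<bullet> f = q2 - x2"
      "(q - p) \<bullet> e = q1 - p1" "(q - p) \<bullet> f = q2 - p2" "((p - c) + (q - c)) \<bullet> e = p1 + q1"
      "((p - c) + (q - c)) \<bullet> f = p2 + q2"
      by (simp_all add: defs inner_diff_left inner_add_left)
    \<comment> \<open>The line from the centre to the midpoint of a chord is perpendicular to the
      chord.\<close>
    have orth: "(p1 + q1) * (q1 - p1) + (p2 + q2) * (q2 - p2) = 0"
      using P Q by (simp add: algebra_simps)
    have r: "r\<^sup>2 = (p1 * p1 + p2 * p2 + q1 * q1 + q2 * q2) / 2" using P Q by simp
    \<comment> \<open>With \<open>r\<close> eliminated symmetrically in \<open>p\<close> and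
      \<open>q\<close>, the claim is a polynomial identity up to a multiple of the expression that
      vanishes by \<open>orth\<close>.\<close>
    have "l * (N x - pow x) = k * D x - ((p1 + q1) * (q1 - p1) + (p2 + q2) * (q2 - p2)) *
        ((x1 - (p1 + q1) / 2) * (q1 - p1) + (x2 - (p2 + q2) / 2) * (q2 - p2))"
      unfolding l_def k_def N_def pow_def D_def cr i[of "p - x" "q - x"] i[of "x - c" "x - c"]
        i[of "q - p" "q - p"] d defs(5,6)[symmetric] r
      by (simp add: field_simps)
    then show ?thesis unfolding orth by simp
  qed
  have Da: "D a \<noteq> 0" "D b \<noteq> 0" using opp by (auto simp: D_def)
  have "l \<noteq> 0"
  proof
    assume "l = 0"
    then have "q = p" by (simp add: l_def)
    then show False using Da by (simp add: D_def cr)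
  qed
  then have l: "l > 0" by (simp add: l_def)
  have na: "N a = k / l * D a" and nb: "N b = pow b + k / l * D b"
    using Nx[of a] Nx[of b] a l by (simp_all add: field_simps)
  \<comment> \<open>\<open>D a\<close> and \<open>D b\<close> have opposite signs, so the two terms
    with \<open>k / l\<close> cancel and only the power of \<open>b\<close> is left.\<close>
  have "N a / \<bar>D a\<bar> + N b / \<bar>D b\<bar> = pow b / \<bar>D b\<bar>"
  proof (cases "D a > 0")
    case True
    then have "D b < 0" using opp by (simp add: D_def zero_less_mult_iff mult_less_0_iff)
    then show ?thesis using True by (simp add: na nb add_divide_distrib)
  next
    case False
    then have "D a < 0" "D b > 0" using opp by (auto simp: D_def mult_less_0_iff)
    then show ?thesis by (simp add: na nb add_divide_distrib)
  qed
  then show ?thesis using b by (simp add: N_def D_def)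
qed

text \<open>By Lagrange's identity a zero determinant is equality in the Cauchy-Schwarz inequality,
  which makes the points collinear.\<close>

lemma cross2_nonzero_of_affine_independent:
  fixes p q a :: "'a::euclidean_space"
  assumes "DIM('a) = 2" and "\<not> affine_dependent {p, q, a}" and "p \<noteq> q" "p \<noteq> a" "q \<noteq> a"
  shows "cross2 (p - a) (q - a) \<noteq> 0"
proof
  assume "cross2 (p - a) (q - a) = 0"
  then have "\<bar>(p - a) \<bullet> (q - a)\<bar>\<^sup>2 = (norm (p - a) * norm (q - a))\<^sup>2"
    using cross2_square[OF assms(1), of "p - a" "q - a"] by simp
  then have "\<bar>(p - a) \<bullet> (q - a)\<bar> = norm (p - a) * norm (q - a)"
    by (rule power2_eq_imp_eq) simp_all
  then have "collinear {0, p - a, q - a}" by (simp only: norm_cauchy_schwarz_equal)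
  then have "collinear {p, a, q}" by (subst collinear_3) (auto simp: NO_MATCH_def)
  then show False using assms by (auto simp: collinear_3_eq_affine_dependent insert_commute)
qed

text \<open>Near the midpoint of \<open>p\<close> and \<open>q\<close>, the segment towards
  \<open>a\<close> runs inside the triangle with apex \<open>b\<close> if both apexes lie on the
  same side. A point there lies in the common face, and a face containing an inner point of a
  segment of the triangle contains its ends, in particular \<open>a\<close>.\<close>

lemma same_side_imp_mem:
  fixes p q a b :: "'a::euclidean_space"
  assumes dim: "DIM('a) = 2"
    and same: "cross2 (p - a) (q - a) * cross2 (p - b) (q - b) > 0"
    and face: "convex hull {p, q, a} \<inter> convex hull {p, q, b} face_of convex hull {p, q, a}"
  shows "a \<in> convex hull {p, q, b}"
proof -
  obtain e f :: 'a where ef: "Basis = {e, f}"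
    and cr: "\<And>x y. cross2 x y = (x \<bullet> e) * (y \<bullet> f) - (x \<bullet> f) * (y \<bullet> e)"
    using cross2_coordinates[OF dim] by metis
  let ?D = "\<lambda>x. cross2 (p - x) (q - x)"
  let ?m = "(1 / 2) *\<^sub>R p + (1 / 2) *\<^sub>R q"
  \<comment> \<open>Cramer's rule: \<open>s\<close> and \<open>t\<close> are the barycentric
    coordinates of \<open>a\<close> at \<open>q\<close> and \<open>b\<close>. The sign of
    \<open>t\<close> records the side of the line on which \<open>a\<close> lies relative to
    \<open>b\<close>.\<close>
  define t where "t = ?D a / ?D b"
  define s where "s = cross2 (a - p) (b - p) / ?D b"
  have Db: "?D b \<noteq> 0" using same by auto
  have t: "t > 0" using same by (auto simp: t_def zero_less_mult_iff zero_less_divide_iff)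
  have a: "a = (1 - s - t) *\<^sub>R p + s *\<^sub>R q + t *\<^sub>R b"
  proof -
    have "?D b *\<^sub>R (a - p) = cross2 (a - p) (b - p) *\<^sub>R (q - p) + ?D a *\<^sub>R (b - p)"
    proof (rule euclidean_eqI)
      fix v :: 'a assume "v \<in> Basis"
      then show "(?D b *\<^sub>R (a - p)) \<bullet> v = (cross2 (a - p) (b - p) *\<^sub>R (q - p) + ?D a *\<^sub>R (b - p)) \<bullet> v"
        unfolding ef cr by (auto simp: inner_diff_left inner_add_left algebra_simps)
    qed
    then have "a - p = (1 / ?D b) *\<^sub>R (cross2 (a - p) (b - p) *\<^sub>R (q - p) + ?D a *\<^sub>R (b - p))"
      using Db by (metis scaleR_scaleR divide_self_if mult.commute scaleR_one times_divide_eq_left mult_1)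
    then have "a - p = s *\<^sub>R (q - p) + t *\<^sub>R (b - p)"
      by (simp add: s_def t_def scaleR_right_distrib)
    then show ?thesis by (simp add: algebra_simps)
  qed
  \<comment> \<open>The step is so short that the total change
    \<open>h * (1 + \<bar>s\<bar> + \<bar>1 - s - t\<bar>)\<close> is one half; the coordinates at
    \<open>p\<close> and \<open>q\<close> then stay nonnegative whatever the signs of
    \<open>s\<close> and \<open>1 - s - t\<close>.\<close>
  define h where "h = 1 / (2 * (1 + \<bar>s\<bar> + \<bar>1 - s - t\<bar>))"
  have pos: "0 < 2 * (1 + \<bar>s\<bar> + \<bar>1 - s - t\<bar>)" by (simp add: add_pos_nonneg)
  then have h0: "h > 0" by (simp add: h_def)
  have "h * (1 + \<bar>s\<bar> + \<bar>1 - s - t\<bar>) = 1 / 2" using pos by (simp add: h_def)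
  then have h: "h + h * \<bar>s\<bar> + h * \<bar>1 - s - t\<bar> = 1 / 2" by (simp add: algebra_simps)
  have hs: "0 \<le> h * \<bar>s\<bar>" "0 \<le> h * \<bar>1 - s - t\<bar>" using h0 by simp_all
  have hm: "- (h * \<bar>s\<bar>) \<le> h * s" "- (h * \<bar>1 - s - t\<bar>) \<le> h * (1 - s - t)"
    using h0 mult_left_mono[of "- \<bar>s\<bar>" s h] mult_left_mono[of "- \<bar>1 - s - t\<bar>" "1 - s - t" h] by auto
  have h1: "h < 1" using h hs by linarith
  define x where "x = (1 - h) *\<^sub>R ?m + h *\<^sub>R a"
  have m: "?m \<in> convex hull {p, q, z}" for z
    by (intro convexD[OF convex_convex_hull]) (auto intro: hull_inc)
  have aK: "a \<in> convex hull {p, q, a}" by (simp add: hull_inc)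
  have "x \<in> convex hull {p, q, a}"
    unfolding x_def by (rule convexD[OF convex_convex_hull m aK]) (use h0 h1 in auto)
  moreover have "x \<in> convex hull {p, q, b}"
  proof -
    have "x = ((1 - h) / 2 + h * (1 - s - t)) *\<^sub>R p + ((1 - h) / 2 + h * s) *\<^sub>R q + (h * t) *\<^sub>R b"
      unfolding x_def by (subst a) (simp add: algebra_simps)
    moreover have "0 \<le> (1 - h) / 2 + h * (1 - s - t)" "0 \<le> (1 - h) / 2 + h * s"
      using hm hs h h0 unfolding diff_divide_distrib by linarith+
    moreover have "0 \<le> h * t" using h0 t by simp
    moreover have "((1 - h) / 2 + h * (1 - s - t)) + ((1 - h) / 2 + h * s) + h * t = 1"
      by (simp add: field_simps)
    ultimately show ?thesis unfolding convex_hull_3 by blast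
  qed
  moreover have "x \<in> open_segment ?m a"
  proof -
    have "?m \<noteq> a"
    proof
      assume "?m = a"
      then have "a = (1 / 2) *\<^sub>R p + (1 / 2) *\<^sub>R q" by simp
      then have "?D a = 0" unfolding cr by (simp add: inner_diff_left inner_add_left field_simps)
      then show False using same by simp
    qed
    then show ?thesis unfolding in_segment x_def using h0 h1 by blast
  qed
  ultimately have "a \<in> convex hull {p, q, a} \<inter> convex hull {p, q, b}"
    using face m aK unfolding face_of_def by blast
  then show ?thesis by blast
qed

section \<open>Angles and weights of a triangle\<close>

lemma facet_angle_segments:
  fixes a p q :: "'a::euclidean_space"
  assumes "closed_segment a p \<inter> closed_segment a q = {a}" and "p \<noteq> a" and "q \<noteq> a"
  shows "facet_angle (closed_segment a p) (closed_segment a q) = vec_angle (p - a) (q - a)"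
proof -
  let ?F = "closed_segment a p" and ?G = "closed_segment a q"
  \<comment> \<open>The two segments meet only in \<open>a\<close>, so every point projects to
    \<open>a\<close>.\<close>
  have hull: "affine hull (?F \<inter> ?G) = {a}" using assms(1) by simp
  have cp: "closest_point {a} x = a" for x
    using closest_point_in_set[of "{a}" x] by simp
  have scale: "\<exists>s>0. x - a = s *\<^sub>R (y - a)" if xy: "x \<in> closed_segment a y" "x \<noteq> a" for x y
  proof -
    obtain u where u: "0 \<le> u" "x = (1 - u) *\<^sub>R a + u *\<^sub>R y" using xy(1) by (auto simp: in_segment)
    then have "x - a = u *\<^sub>R (y - a)" by (simp add: algebra_simps)
    moreover have "u \<noteq> 0" using calculation xy(2) by auto
    ultimately show ?thesis using u(1) by (intro exI[of _ u]) simp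
  qed
  \<comment> \<open>Other points of the segments only rescale the two directions by positive
    factors, so the definite description in \<open>facet_angle\<close> has a unique value.\<close>
  have ang: "vec_angle (x - a) (y - a) = vec_angle (p - a) (q - a)" if xy: "x \<in> ?F - ?G" "y \<in> ?G - ?F" for x y
  proof -
    have "x \<noteq> a" "y \<noteq> a" using xy by auto
    obtain s where "s > 0" "x - a = s *\<^sub>R (p - a)" using scale[of x p] xy \<open>x \<noteq> a\<close> by blast
    moreover obtain t where "t > 0" "y - a = t *\<^sub>R (q - a)" using scale[of y q] xy \<open>y \<noteq> a\<close> by blast
    ultimately show ?thesis by (simp add: vec_angle_def)
  qed
  have "p \<in> ?F" "q \<in> ?G" by simp_all
  then have "p \<in> ?F - ?G" "q \<in> ?G - ?F" using assms by blast+
  then show ?thesis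
    unfolding facet_angle_def hull cp using ang by (intro the_equality) blast+
qed

text \<open>The facets not containing the edge are the two sides at the apex \<open>a\<close>. They
  meet in that point, whose measure is 1, and the dimensional factor is 1/2.\<close>

lemma local_weight_triangle:
  fixes p q a :: "'a::euclidean_space"
  assumes dim: "DIM('a) = 2" and ind: "\<not> affine_dependent {p, q, a}"
    and ne: "p \<noteq> q" "p \<noteq> a" "q \<noteq> a"
  shows "local_weight (convex hull {p, q, a}) (closed_segment p q) =
    1 / 2 * (((p - a) \<bullet> (q - a)) / \<bar>cross2 (p - a) (q - a)\<bar>)"
proof -
  let ?S = "{p, q, a}"
  let ?K = "convex hull ?S"
  let ?F = "closed_segment a p" and ?G = "closed_segment a q"
  have ext: "x extreme_point_of ?K \<longleftrightarrow> x \<in> ?S" for x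
    by (rule extreme_point_of_convex_hull_affine_independent[OF ind])
  have notin: "x \<notin> closed_segment y z" if "x \<in> ?S" "y \<in> ?S" "z \<in> ?S" "x \<noteq> y" "x \<noteq> z" for x y z
  proof
    assume "x \<in> closed_segment y z"
    then have "x \<in> open_segment y z" using that by (simp add: open_segment_def)
    moreover have "y \<in> ?K" "z \<in> ?K" using that hull_subset[of ?S convex] by auto
    ultimately show False using ext[of x] that(1) by (auto simp: extreme_point_of_def)
  qed
  \<comment> \<open>The intersection is a face, hence the hull of some vertices; \<open>p\<close>
    and \<open>q\<close> are extreme and lie on no segment between other vertices, which leaves
    \<open>a\<close>.\<close>
  have int: "?F \<inter> ?G = {a}"
  proof -
    have fp: "?F face_of ?K"
      unfolding face_of_convex_hull_affine_independent[OF ind] segment_convex_hull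
      by (intro exI[of _ "{a, p}"]) simp
    have fq: "?G face_of ?K"
      unfolding face_of_convex_hull_affine_independent[OF ind] segment_convex_hull
      by (intro exI[of _ "{a, q}"]) simp
    have "?F \<inter> ?G face_of ?K" by (rule face_of_Int[OF fp fq])
    then obtain C where C: "C \<subseteq> ?S" "?F \<inter> ?G = convex hull C"
      using face_of_convex_hull_affine_independent[OF ind, of "?F \<inter> ?G"] by (elim iffD1[elim_format] exE conjE)
    have "p \<notin> C" "q \<notin> C"
      using notin[of p a q] notin[of q a p] ne C(2) hull_subset[of C convex] by auto
    then have "C \<subseteq> {a}" using C(1) by auto
    then have "?F \<inter> ?G \<subseteq> {a}" unfolding C(2) using hull_mono[of C "{a}" convex] by simp
    then show ?thesis by auto
  qed
  have opp: "opposite_facets ?K (closed_segment p q) = {?F, ?G}"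
  proof -
    have "F facet_of ?K \<longleftrightarrow> F = ?F \<or> F = ?G \<or> F = closed_segment p q" for F
    proof -
      have d: "?S - {p} = {a, q}" "?S - {q} = {a, p}" "?S - {a} = {p, q}" using ne by auto
      have "2 \<le> card ?S" using ne by simp
      then have "F facet_of ?K \<longleftrightarrow> (\<exists>u\<in>?S. F = convex hull (?S - {u}))"
        unfolding facet_of_convex_hull_affine_independent_alt[OF ind] Bex_def by (simp only: simp_thms)
      also have "\<dots> \<longleftrightarrow> F = convex hull (?S - {p}) \<or> F = convex hull (?S - {q}) \<or> F = convex hull (?S - {a})"
        by (simp only: bex_simps simp_thms)
      also have "\<dots> \<longleftrightarrow> F = ?F \<or> F = ?G \<or> F = closed_segment p q"
        unfolding d segment_convex_hull by (rule disj_left_commute)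
      finally show ?thesis .
    qed
    moreover have "\<not> closed_segment p q \<subseteq> ?F" "\<not> closed_segment p q \<subseteq> ?G"
      using notin[of q a p] notin[of p a q] ne by auto
    ultimately show ?thesis unfolding opposite_facets_def by auto
  qed
  have FG: "?F \<noteq> ?G" using notin[of p a q] ne by auto
  have ang: "facet_angle ?F ?G = vec_angle (p - a) (q - a)"
    using ne by (intro facet_angle_segments[OF int]) auto
  \<comment> \<open>The pair of facets in \<open>theta\<close> is unordered, so uniqueness requires
    the same angle for both orders.\<close>
  have ang': "facet_angle ?G ?F = vec_angle (p - a) (q - a)"
    using facet_angle_segments[of a q p] int ne by (simp add: Int_commute vec_angle_def inner_commute mult.commute)
  have "theta ?K (closed_segment p q) = vec_angle (p - a) (q - a)"
    unfolding theta_def opp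
  proof (rule the_equality)
    show "\<exists>F G. {?F, ?G} = {F, G} \<and> F \<noteq> G \<and> vec_angle (p - a) (q - a) = facet_angle F G"
      by (rule exI[of _ ?F], rule exI[of _ ?G]) (simp only: ang FG simp_thms not_False_eq_True)
    fix t assume "\<exists>F G. {?F, ?G} = {F, G} \<and> F \<noteq> G \<and> t = facet_angle F G"
    then show "t = vec_angle (p - a) (q - a)" using ang ang' by (elim exE conjE) (auto simp only: doubleton_eq_iff)
  qed
  moreover have "kappa_measure (kappa ?K (closed_segment p q)) = 1"
    by (simp add: kappa_def opp int kappa_measure_def)
  ultimately show ?thesis
    using cot_vec_angle[OF dim, of "p - a" "q - a"] ne dim by (simp add: local_weight_def)
qed

section \<open>Edges of a Delaunay mesh in the plane\<close>

lemma mesh_edge_segment: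
  assumes mesh: "simplicial_mesh \<Omega> T" and K: "K \<in> T" and E: "E edge_of K"
  obtains p q where "p \<noteq> q" and "E = closed_segment p q" and "verts E = {p, q}" and "{p, q} \<subseteq> verts K"
proof -
  have E: "E face_of K" "aff_dim E = 1" using E by (auto simp: edge_of_def)
  have h: "E = convex hull (verts E)" and sub: "verts E \<subseteq> verts K"
    using mesh_face_verts[OF mesh K E(1)] by auto
  have ind: "\<not> affine_dependent (verts E)"
    using simplicial_mesh_element(1)[OF mesh K] sub by (rule affine_independent_subset)
  have "aff_dim (verts E) = 1" using E(2) h aff_dim_convex_hull by metis
  then have "card (verts E) = 2" using aff_dim_affine_independent[OF ind] by simp
  then obtain p q where pq: "verts E = {p, q}" "p \<noteq> q" by (auto simp: card_2_iff)
  show thesis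
  proof (rule that[OF pq(2) _ pq(1)])
    show "E = closed_segment p q" using h pq(1) by (simp add: segment_convex_hull)
    show "{p, q} \<subseteq> verts K" using sub pq(1) by simp
  qed
qed

text \<open>Two different triangles on one edge lie on opposite sides of it: on the same side each
  would contain the apex of the other, and they would coincide. The empty circumdisc of
  \<open>K\<close> then excludes the apex of \<open>L\<close>, which controls the sum of the two
  cotangents.\<close>

lemma delaunay_pair_weight_nonneg:
  fixes T :: "'a::euclidean_space set set"
  assumes dim: "DIM('a) = 2" and mesh: "simplicial_mesh \<Omega> T" and del: "delaunay T"
    and K: "K \<in> T" "E edge_of K" and L: "L \<in> T" "E edge_of L" and "K \<noteq> L"
  shows "0 \<le> local_weight K E + local_weight L E"
proof -
  note el = simplicial_mesh_element[OF mesh]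
  obtain p q where pq: "p \<noteq> q" "E = closed_segment p q" "verts E = {p, q}"
    using mesh_edge_segment[OF mesh K] by metis
  have apex: "\<exists>a. verts M = {p, q, a} \<and> p \<noteq> a \<and> q \<noteq> a" if M: "M \<in> T" "E edge_of M" for M
  proof -
    have sub: "{p, q} \<subseteq> verts M" using mesh_face_verts(2)[OF mesh M(1)] M(2) pq(3) by (auto simp: edge_of_def)
    then have "card (verts M - {p, q}) = 1"
      using el(2,4)[OF M(1)] dim pq(1) by (subst card_Diff_subset) auto
    then obtain a where "verts M - {p, q} = {a}" by (auto simp: card_1_singleton_iff)
    then show ?thesis using sub by blast
  qed
  obtain a where a: "verts K = {p, q, a}" "p \<noteq> a" "q \<noteq> a" using apex[OF K] by blast
  obtain b where b: "verts L = {p, q, b}" "p \<noteq> b" "q \<noteq> b" using apex[OF L] by blast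
  have ind: "\<not> affine_dependent {p, q, a}" "\<not> affine_dependent {p, q, b}"
    using el(1)[OF K(1)] el(1)[OF L(1)] a(1) b(1) by simp_all
  have hull: "K = convex hull {p, q, a}" "L = convex hull {p, q, b}"
    using el(3)[OF K(1)] el(3)[OF L(1)] a(1) b(1) by simp_all
  have faces: "K \<inter> L face_of K" "L \<inter> K face_of L"
    using mesh K(1) L(1) by (auto simp: simplicial_mesh_def triangulation_def)
  let ?D = "\<lambda>x. cross2 (p - x) (q - x)"
  have "\<not> 0 < ?D a * ?D b"
  proof
    assume pos: "0 < ?D a * ?D b"
    have "a \<in> L" using same_side_imp_mem[OF dim pos] faces(1) hull by simp
    moreover have "b \<in> K"
      using same_side_imp_mem[OF dim, where a=b and b=a and p=p and q=q] pos faces(2) hull by (simp add: mult.commute)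
    moreover have "p \<in> K" "q \<in> K" "p \<in> L" "q \<in> L" unfolding hull by (simp_all add: hull_inc)
    ultimately have "convex hull {p, q, a} \<subseteq> L" "convex hull {p, q, b} \<subseteq> K"
      using el(6)[OF K(1)] el(6)[OF L(1)] by (intro hull_minimal; simp)+
    then show False using hull \<open>K \<noteq> L\<close> by simp
  qed
  then have opp: "?D a * ?D b < 0"
    using cross2_nonzero_of_affine_independent[OF dim ind(1) pq(1) a(2,3)]
      cross2_nonzero_of_affine_independent[OF dim ind(2) pq(1) b(2,3)]
    by (metis linorder_neqE_linordered_idom mult_eq_0_iff)
  obtain c r where cr: "verts K \<subseteq> sphere c r" "ball c r \<inter> mesh_verts T = {}"
    using del K(1) by (auto simp: delaunay_def)
  have "b \<in> mesh_verts T" using L(1) b(1) by (auto simp: mesh_verts_def)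
  then have "b \<notin> ball c r" using cr(2) by blast
  then have "0 \<le> ((p - a) \<bullet> (q - a)) / \<bar>?D a\<bar> + ((p - b) \<bullet> (q - b)) / \<bar>?D b\<bar>"
    using opposite_angles_cot_sum_nonneg[OF dim _ _ _ _ opp, of c r] cr(1) a(1) by simp
  then show ?thesis
    using local_weight_triangle[OF dim ind(1) pq(1) a(2,3)] local_weight_triangle[OF dim ind(2) pq(1) b(2,3)]
      hull pq(2) by simp
qed

text \<open>If one term is negative, every other term outweighs it, so one of them compensates it
  and the rest are nonnegative. This serves interior edges, for which the definition of
  \<open>boundary_edge\<close> yields only that at least two triangles share them.\<close>

lemma sum_nonneg_of_pairs:
  fixes w :: "'b \<Rightarrow> real"
  assumes fin: "finite S" and card: "card S \<ge> 2"
    and pair: "\<And>x y. x \<in> S \<Longrightarrow> y \<in> S \<Longrightarrow> x \<noteq> y \<Longrightarrow> 0 \<le> w x + w y"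
  shows "0 \<le> sum w S"
proof (cases "\<forall>x\<in>S. 0 \<le> w x")
  case True
  then show ?thesis by (simp add: sum_nonneg)
next
  case False
  then obtain x where x: "x \<in> S" "w x < 0" by force
  have "card (S - {x}) \<ge> 1" using card x fin by simp
  then obtain y where y: "y \<in> S" "y \<noteq> x" by (metis Diff_iff card.empty ex_in_conv insertI1 not_one_le_zero)
  have "w y \<le> sum w (S - {x})"
  proof (rule member_le_sum)
    show "0 \<le> w z" if "z \<in> S - {x} - {y}" for z using pair[of x z] x that by force
  qed (use y fin in auto)
  then have "w x + w y \<le> sum w S" using fin x by (simp add: sum.remove)
  then show ?thesis using pair[of x y] x y by force
qed

lemma delaunay_interior_edge_weight_nonneg:
  fixes T :: "'a::euclidean_space set set"
  assumes "DIM('a) = 2" and "simplicial_mesh \<Omega> T" and "delaunay T"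
    and "E \<in> mesh_edges T" and "\<not> boundary_edge T E"
  shows "0 \<le> edge_weight T E"
  unfolding edge_weight_def
proof (rule sum_nonneg_of_pairs)
  let ?S = "{K \<in> T. E edge_of K}"
  show fin: "finite ?S" using assms(2) by (simp add: simplicial_mesh_def triangulation_def)
  have "?S \<noteq> {}" using assms(4) by (auto simp: mesh_edges_def)
  then have "card ?S \<noteq> 0" using fin by simp
  then show "2 \<le> card ?S" using assms(5) by (simp add: boundary_edge_def)
  show "0 \<le> local_weight K E + local_weight L E" if "K \<in> ?S" "L \<in> ?S" "K \<noteq> L" for K L
    using that delaunay_pair_weight_nonneg[OF assms(1-3)] by blast
qed

subsection \<open>The maximum principle\<close>

lemma harmonic_avg_nonneg:
  assumes "\<And>x. 0 \<le> \<gamma> x"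
  shows "0 \<le> harmonic_avg \<gamma> E"
proof -
  have "0 \<le> edge_integral E (\<lambda>x. 1 / \<gamma> x)"
    unfolding edge_integral_def
  proof (cases "(\<lambda>t. 1 / \<gamma> (linepath (fst (edge_ends E)) (snd (edge_ends E)) t) * edge_length E)
      integrable_on {0..1}")
    case True
    then show "0 \<le> integral {0..1} (\<lambda>t. 1 / \<gamma> (linepath (fst (edge_ends E)) (snd (edge_ends E)) t) * edge_length E)"
      by (rule integral_nonneg) (use assms in \<open>auto simp: edge_length_def\<close>)
  next
    \<comment> \<open>A non-integrable integrand has integral 0 by convention.\<close>
    case False
    then show "0 \<le> integral {0..1} (\<lambda>t. 1 / \<gamma> (linepath (fst (edge_ends E)) (snd (edge_ends E)) t) * edge_length E)"
      by (simp add: not_integrable_integral)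
  qed
  then show ?thesis by (simp add: harmonic_avg_def edge_length_def)
qed

text \<open>Any pair that the choice operator can return consists of the extreme points of the
  segment, in one order or the other.\<close>

lemma edge_ends_in_verts:
  fixes E :: "'a::euclidean_space set"
  assumes mesh: "simplicial_mesh \<Omega> T" and "K \<in> T" and "E edge_of K"
  shows "fst (edge_ends E) \<in> verts K" and "snd (edge_ends E) \<in> verts K"
proof -
  obtain p q where pq: "E = closed_segment p q" "verts E = {p, q}" "{p, q} \<subseteq> verts K"
    using mesh_edge_segment[OF assms] by metis
  have "verts (closed_segment a b) = {a, b}" for a b :: 'a
    by (auto simp: verts_def extreme_point_of_segment)
  moreover have "E = closed_segment (fst (edge_ends E)) (snd (edge_ends E))"
    using someI[of "\<lambda>(p, q). E = closed_segment p q" "(p, q)"] pq(1)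
    by (simp add: edge_ends_def case_prod_beta)
  ultimately have "verts E = {fst (edge_ends E), snd (edge_ends E)}" by metis
  then show "fst (edge_ends E) \<in> verts K" "snd (edge_ends E) \<in> verts K" using pq(2,3) by auto
qed

text \<open>The sign has three sources: the inverse length in dimension 1, the Delaunay condition at
  interior edges in the plane, and the hypothesis at planar boundary edges and in dimension
  3.\<close>

lemma mesh_edge_weight_nonneg:
  fixes T :: "'a::euclidean_space set set"
  assumes dim: "DIM('a) \<in> {1, 2, 3}" and mesh: "simplicial_mesh \<Omega> T" and del: "delaunay T"
    and w: "\<forall>E\<in>mesh_edges T.
           DIM('a) = 2 \<and> boundary_edge T E \<or> DIM('a) = 3 \<longrightarrow> 0 \<le> edge_weight T E"
    and E: "E \<in> mesh_edges T"
  shows "0 \<le> edge_weight T E"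
proof (cases "DIM('a) = 1")
  case True
  then show ?thesis by (simp add: edge_weight_def local_weight_def sum_nonneg)
next
  case False
  show ?thesis
  proof (cases "DIM('a) = 3 \<or> boundary_edge T E")
    case True
    then show ?thesis using w E dim False by auto
  next
    case interior: False
    then have "DIM('a) = 2" using dim False by auto
    then show ?thesis
      using delaunay_interior_edge_weight_nonneg[OF _ mesh del E] interior by blast
  qed
qed

text \<open>A local weight is negative opposite an obtuse angle; a sign is available only for the
  sum over all elements around an edge, hence the regrouping.\<close>

lemma stiffness_op_eq_edge_sum:
  fixes T :: "'a::euclidean_space set set"
  assumes mesh: "simplicial_mesh \<Omega> T"
  shows "stiffness_op T \<gamma> \<alpha> \<beta> =
    (\<Sum>E\<in>mesh_edges T. edge_weight T E * harmonic_avg \<gamma> E * edge_diff E \<alpha> * edge_diff E \<beta>)"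
proof -
  let ?h = "\<lambda>E. harmonic_avg \<gamma> E * edge_diff E \<alpha> * edge_diff E \<beta>"
  have fin: "finite T" using mesh by (simp add: simplicial_mesh_def triangulation_def)
  have "finite {E. E edge_of K}" if "K \<in> T" for K
    using finite_polytope_faces[OF simplicial_mesh_element(8)[OF mesh that]]
    by (rule rev_finite_subset) (auto simp: edge_of_def)
  moreover have edges: "mesh_edges T = (\<Union>K\<in>T. {E. E edge_of K})" by (auto simp: mesh_edges_def)
  ultimately have finE: "finite (mesh_edges T)" using fin by simp
  have "stiffness_op T \<gamma> \<alpha> \<beta> = (\<Sum>K\<in>T. \<Sum>E\<in>{E\<in>mesh_edges T. E edge_of K}. local_weight K E * ?h E)"
    unfolding stiffness_op_def
    by (intro sum.cong) (auto simp: mesh_edges_def mult.assoc)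
  also have "\<dots> = (\<Sum>E\<in>mesh_edges T. \<Sum>K\<in>{K\<in>T. E edge_of K}. local_weight K E * ?h E)"
    by (rule sum.swap_restrict[OF fin finE])
  also have "\<dots> = (\<Sum>E\<in>mesh_edges T. edge_weight T E * ?h E)"
    by (simp add: edge_weight_def sum_distrib_right)
  finally show ?thesis by (simp add: mult.assoc)
qed

lemma stiffness_op_nonneg:
  assumes mesh: "simplicial_mesh \<Omega> T" and "\<And>E. E \<in> mesh_edges T \<Longrightarrow> 0 \<le> edge_weight T E"
    and "\<And>x. 0 \<le> \<gamma> x"
    and mono: "\<And>v w. v \<in> mesh_verts T \<Longrightarrow> w \<in> mesh_verts T \<Longrightarrow> 0 \<le> (\<alpha> v - \<alpha> w) * (\<beta> v - \<beta> w)"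
  shows "0 \<le> stiffness_op T \<gamma> \<alpha> \<beta>"
  unfolding stiffness_op_eq_edge_sum[OF mesh]
proof (rule sum_nonneg)
  fix E assume E: "E \<in> mesh_edges T"
  then obtain K where K: "K \<in> T" "E edge_of K" by (auto simp: mesh_edges_def)
  have "0 \<le> edge_diff E \<alpha> * edge_diff E \<beta>"
    unfolding edge_diff_def
    by (rule mono) (use edge_ends_in_verts[OF mesh K] K in \<open>auto simp: mesh_verts_def\<close>)
  moreover have "0 \<le> edge_weight T E * harmonic_avg \<gamma> E"
    using assms(2)[OF E] harmonic_avg_nonneg[of \<gamma> E] assms(3) by simp
  ultimately show "0 \<le> edge_weight T E * harmonic_avg \<gamma> E * edge_diff E \<alpha> * edge_diff E \<beta>"
    by (metis mult.assoc mult_nonneg_nonneg)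
qed

lemma mesh_element_volume_pos:
  assumes mesh: "simplicial_mesh \<Omega> T" and "K \<in> T"
  shows "0 < measure lebesgue K"
proof -
  have "\<not> negligible K"
    using simplicial_mesh_element(6,7)[OF assms] negligible_convex_interior by blast
  moreover have "K \<in> lmeasurable"
    using simplicial_mesh_element(5)[OF assms] by (rule lmeasurable_compact)
  ultimately show ?thesis by (metis negligible_iff_measure zero_less_measure_iff)
qed

text \<open>Each mesh vertex belongs to an element of positive volume, so its product enters the
  lumped sum with a positive weight.\<close>

lemma mass_op_nonneg_eq_0:
  fixes T :: "'a::euclidean_space set set"
  assumes mesh: "simplicial_mesh \<Omega> T" and nonneg: "\<And>v. v \<in> mesh_verts T \<Longrightarrow> 0 \<le> \<alpha> v * \<beta> v"
  shows "0 \<le> mass_op T \<alpha> \<beta>"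
    and "mass_op T \<alpha> \<beta> = 0 \<Longrightarrow> v \<in> mesh_verts T \<Longrightarrow> \<alpha> v * \<beta> v = 0"
proof -
  let ?t = "\<lambda>K v. measure lebesgue K / (real DIM('a) + 1) * \<alpha> v * \<beta> v"
  have fin: "finite T" using mesh by (simp add: simplicial_mesh_def triangulation_def)
  have t: "0 \<le> ?t K v" if "K \<in> T" "v \<in> verts K" for K v
  proof -
    have "0 \<le> \<alpha> v * \<beta> v" using nonneg that by (auto simp: mesh_verts_def)
    then have "0 \<le> measure lebesgue K / (real DIM('a) + 1) * (\<alpha> v * \<beta> v)"
      by (rule mult_nonneg_nonneg[rotated]) simp
    then show ?thesis by (simp add: mult.assoc)
  qed
  show "0 \<le> mass_op T \<alpha> \<beta>" unfolding mass_op_def by (intro sum_nonneg t)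
  assume z: "mass_op T \<alpha> \<beta> = 0" and "v \<in> mesh_verts T"
  then obtain K where K: "K \<in> T" "v \<in> verts K" by (auto simp: mesh_verts_def)
  have "(\<Sum>v\<in>verts K. ?t K v) = 0"
    using z[unfolded mass_op_def] sum_nonneg_eq_0_iff[OF fin, of "\<lambda>K. \<Sum>v\<in>verts K. ?t K v"] t K(1)
    by (simp add: sum_nonneg)
  then have "?t K v = 0"
    using sum_nonneg_eq_0_iff[OF simplicial_mesh_element(4)[OF mesh K(1)], of "?t K"] t K by blast
  then show "\<alpha> v * \<beta> v = 0" using mesh_element_volume_pos[OF mesh K(1)] by auto
qed

text \<open>Common core of both bounds: the truncations from above and from below are both monotone
  functions \<psi> of \<open>u\<close>. Two nonnegative operators add up to 0, so the mass term
  vanishes vertex by vertex.\<close>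

lemma scheme_vertex_test:
  fixes u :: "'a::euclidean_space \<Rightarrow> real" and \<psi> :: "real \<Rightarrow> real"
  assumes \<Omega>: "open \<Omega>" "bounded \<Omega>" and mesh: "simplicial_mesh \<Omega> T"
    and weights: "\<And>E. E \<in> mesh_edges T \<Longrightarrow> 0 \<le> edge_weight T E"
    and m: "0 \<le> m" and sol: "scheme_solution \<Omega> T m \<Delta>t u_old u" and \<Delta>t: "0 < \<Delta>t"
    and \<psi>: "mono \<psi>"
    and sgn: "\<And>v. v \<in> mesh_verts T \<Longrightarrow> 0 \<le> (exp (u v) - exp (u_old v)) * \<psi> (u v)"
    and v: "v \<in> mesh_verts T"
  shows "exp (u v) = exp (u_old v) \<or> \<psi> (u v) = 0"
proof -
  \<comment> \<open>The composition of \<psi> with \<open>u\<close> is in general not piecewise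
    affine; its interpolant is admissible, and the operators see the test function only at
    vertices.\<close>
  obtain \<beta> where \<beta>: "\<beta> \<in> V_h \<Omega> T" "\<And>v. v \<in> mesh_verts T \<Longrightarrow> \<beta> v = \<psi> (u v)"
    using mesh_interpolant[OF \<Omega> mesh, of "\<lambda>v. \<psi> (u v)"] by metis
  let ?\<alpha> = "\<lambda>x. (exp (u x) - exp (u_old x)) / \<Delta>t"
  have "mass_op T ?\<alpha> \<beta> + stiffness_op T (\<lambda>x. m * exp (m * u_old x)) u \<beta> = 0"
    using sol \<beta>(1) by (simp add: scheme_solution_def)
  moreover have "0 \<le> stiffness_op T (\<lambda>x. m * exp (m * u_old x)) u \<beta>"
  proof (rule stiffness_op_nonneg[OF mesh weights])
    show "0 \<le> (u v - u w) * (\<beta> v - \<beta> w)" if "v \<in> mesh_verts T" "w \<in> mesh_verts T" for v w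
      using monoD[OF \<psi>, of "u v" "u w"] monoD[OF \<psi>, of "u w" "u v"] \<beta>(2) that
      by (cases "u v \<le> u w") (auto simp: zero_le_mult_iff)
  qed (use m in auto)
  moreover have nonneg: "0 \<le> ?\<alpha> v * \<beta> v" if "v \<in> mesh_verts T" for v
    using sgn[OF that] \<beta>(2)[OF that] \<Delta>t by simp
  moreover have "0 \<le> mass_op T ?\<alpha> \<beta>" by (rule mass_op_nonneg_eq_0(1)[OF mesh nonneg])
  ultimately have "mass_op T ?\<alpha> \<beta> = 0" by linarith
  from mass_op_nonneg_eq_0(2)[OF mesh nonneg this v] show ?thesis using \<beta>(2)[OF v] \<Delta>t by auto
qed

section \<open>From bounds at vertices to bounds on the domain\<close>

lemma P1_le_of_verts_le:
  assumes "f \<in> P1_on K" and "K = convex hull (verts K)" and "\<And>v. v \<in> verts K \<Longrightarrow> f v \<le> M" and "x \<in> K"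
  shows "f x \<le> (M::real)"
proof -
  obtain a b where ab: "\<And>y. y \<in> K \<Longrightarrow> f y = a \<bullet> y + b" using assms(1) by (auto simp: P1_on_def)
  have "verts K \<subseteq> K" by (auto simp: verts_def extreme_point_of_def)
  then have "verts K \<subseteq> {y. a \<bullet> y \<le> M - b}" using assms(3) ab by fastforce
  then have "convex hull (verts K) \<subseteq> {y. a \<bullet> y \<le> M - b}" by (rule hull_minimal) (rule convex_halfspace_le)
  then have "a \<bullet> x \<le> M - b" using assms(2,4) by blast
  then show ?thesis using ab[OF assms(4)] by simp
qed

theorem theorem2p3:
  fixes \<Omega> :: "'a::euclidean_space set" and T :: "'a set set"
    and m \<Delta>t \<epsilon>1 \<epsilon>2 :: real and u_old u :: "'a \<Rightarrow> real"
  assumes "DIM('a) \<in> {1, 2, 3}"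
    and "polyhedral_domain \<Omega>"
    and "simplicial_mesh \<Omega> T"
    and "delaunay T"
    and "\<forall>E\<in>mesh_edges T.
           DIM('a) = 2 \<and> boundary_edge T E \<or> DIM('a) = 3 \<longrightarrow> 0 \<le> edge_weight T E"
    and "1 \<le> m"
    and "0 < \<Delta>t"
    and "u_old \<in> V_h \<Omega> T"
    and "scheme_solution \<Omega> T m \<Delta>t u_old u"
    and "0 < \<epsilon>1" and "\<epsilon>1 < \<epsilon>2"
    and "\<forall>x\<in>\<Omega>. \<epsilon>1 \<le> exp (u_old x) \<and> exp (u_old x) \<le> \<epsilon>2"
  shows "\<forall>x\<in>\<Omega>. \<epsilon>1 \<le> exp (u x) \<and> exp (u x) \<le> \<epsilon>2"
proof
  fix x assume x: "x \<in> \<Omega>"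
  note mesh = assms(3) and sol = assms(9)
  have ln1: "ln \<epsilon>1 \<le> s \<longleftrightarrow> \<epsilon>1 \<le> exp s" for s
    using exp_le_cancel_iff[of "ln \<epsilon>1" s] assms(10) by simp
  have ln2: "s \<le> ln \<epsilon>2 \<longleftrightarrow> exp s \<le> \<epsilon>2" for s
    using assms(10,11) by (simp add: ln_ge_iff)
  have \<Omega>: "open \<Omega>" "bounded \<Omega>" using assms(2) by (simp_all add: polyhedral_domain_def)
  have weights: "\<And>E. E \<in> mesh_edges T \<Longrightarrow> 0 \<le> edge_weight T E"
    by (rule mesh_edge_weight_nonneg[OF assms(1,3,4,5)])
  have cov: "\<Union>T = closure \<Omega>" using mesh by (simp add: simplicial_mesh_def)
  have verts_closure: "v \<in> closure \<Omega>" if "v \<in> mesh_verts T" for v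
    using that unfolding cov[symmetric] by (auto simp: mesh_verts_def verts_def extreme_point_of_def)
  \<comment> \<open>The bounds are given on the open domain, whereas vertices may lie on its
    boundary; continuity carries them to the closure.\<close>
  have old: "ln \<epsilon>1 \<le> u_old v" "u_old v \<le> ln \<epsilon>2" if "v \<in> mesh_verts T" for v
  proof -
    have cont: "continuous_on (closure \<Omega>) u_old"
      using piecewise_P1_continuous_on[OF mesh] assms(8) by (simp add: V_h_def)
    have "ln \<epsilon>1 \<le> u_old y" "u_old y \<le> ln \<epsilon>2" if "y \<in> \<Omega>" for y
      using assms(12) that by (simp_all add: ln1 ln2)
    then show "ln \<epsilon>1 \<le> u_old v" "u_old v \<le> ln \<epsilon>2"
      using continuous_ge_on_closure[OF cont verts_closure[OF that]]
        continuous_le_on_closure[OF cont verts_closure[OF that]] by blast+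
  qed
  have upper: "u v \<le> ln \<epsilon>2" if v: "v \<in> mesh_verts T" for v
  proof -
    let ?\<psi> = "\<lambda>s. max (s - ln \<epsilon>2) 0"
    have "exp (u v) = exp (u_old v) \<or> ?\<psi> (u v) = 0"
    proof (rule scheme_vertex_test[OF \<Omega> mesh weights _ sol assms(7) _ _ v])
      show "mono ?\<psi>" by (auto intro!: monoI)
      \<comment> \<open>The positive part is nonzero only where \<open>u w\<close> exceeds
        \<open>ln \<epsilon>2\<close>, and \<open>u_old w\<close> never does, so the first factor is
        positive there.\<close>
      show "0 \<le> (exp (u w) - exp (u_old w)) * ?\<psi> (u w)" if "w \<in> mesh_verts T" for w
        using old(2)[OF that] by (cases "ln \<epsilon>2 \<le> u w") auto
    qed (use assms(6) in auto)
    \<comment> \<open>In the first alternative \<open>u v\<close> equals \<open>u_old v\<close> and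
      inherits its bound.\<close>
    then show ?thesis using old(2)[OF v] by (auto simp: max_def split: if_splits)
  qed
  have lower: "ln \<epsilon>1 \<le> u v" if v: "v \<in> mesh_verts T" for v
  proof -
    let ?\<psi> = "\<lambda>s. min (s - ln \<epsilon>1) 0"
    have "exp (u v) = exp (u_old v) \<or> ?\<psi> (u v) = 0"
    proof (rule scheme_vertex_test[OF \<Omega> mesh weights _ sol assms(7) _ _ v])
      show "mono ?\<psi>" by (auto intro!: monoI)
      show "0 \<le> (exp (u w) - exp (u_old w)) * ?\<psi> (u w)" if "w \<in> mesh_verts T" for w
        using old(1)[OF that] by (cases "ln \<epsilon>1 \<le> u w") (auto intro: mult_nonpos_nonpos)
    qed (use assms(6) in auto)
    then show ?thesis using old(1)[OF v] by (auto simp: min_def split: if_splits)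
  qed
  have "x \<in> \<Union>T" using x cov closure_subset by auto
  then obtain K where K: "K \<in> T" "x \<in> K" by blast
  have hull: "K = convex hull (verts K)" using simplicial_mesh_element(3)[OF mesh K(1)] by simp
  have P1: "u \<in> P1_on K" using sol K(1) by (simp add: scheme_solution_def V_h_def)
  \<comment> \<open>The lower bound inside an element is the upper bound for
    \<open>- u\<close>.\<close>
  then have P1': "(\<lambda>y. - u y) \<in> P1_on K"
  proof -
    obtain a b where "\<forall>y\<in>K. u y = a \<bullet> y + b" using P1 by (auto simp: P1_on_def)
    then have "\<forall>y\<in>K. - u y = (- a) \<bullet> y + (- b)" by simp
    then show ?thesis unfolding P1_on_def by blast
  qed
  have vK: "v \<in> mesh_verts T" if "v \<in> verts K" for v using that K(1) by (auto simp: mesh_verts_def)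
  have "u x \<le> ln \<epsilon>2" by (rule P1_le_of_verts_le[OF P1 hull _ K(2)]) (rule upper[OF vK])
  moreover have "- u x \<le> - ln \<epsilon>1"
    by (rule P1_le_of_verts_le[OF P1' hull _ K(2)]) (simp add: lower[OF vK])
  ultimately show "\<epsilon>1 \<le> exp (u x) \<and> exp (u x) \<le> \<epsilon>2"
    by (simp add: ln1 ln2)
qed

end
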